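(* Let $h\colon S^1\to S^1$ be an orientation-preserving homeomorphism such that $$\int_0^{2\pi} \int_0^{\pi/2} e^{q \rho_h^c(\theta,t)} \, dt\,d\theta <\infty$$ for some $q>0$. Then there exists an extension of $h$ to a homeomorphism of $\mathbb{D}$ that has exponentially integrable distortion.
   Context: $\mathbb{D}$ is the open unit disk in the plane and $S^1=\partial\mathbb{D}$. For $a,b\in S^1$, $\ell(a,b)$ denotes the length of the arc of the circle that connects $a$ to $b$ in the positive orientation. For an orientation-preserving homeomorphism $h\colon S^1\to S^1$, the circular symmetric distortion function is $$\rho_h^c(\theta,t)= \max \left\{ \frac{\ell(h(e^{i\theta}),h(e^{i(\theta+t)}))}{\ell(h(e^{i(\theta-t)}),h(e^{i\theta}))}, \frac{\ell(h(e^{i(\theta-t)}),h(e^{i\theta}))}{\ell(h(e^{i\theta}),h(e^{i(\theta+t)}))} \right\}$$ for $\theta\in[0,2\pi]$ and $t\in(0,\pi/2)$. A homeomorphism $H\colon U\to V$ between open sets $U,V\subset\mathbb{R}^2$ is a mapping of finite distortion if $H$ is orientation-preserving, $H\in W^{1,1}_{\mathrm{loc}}(U)$, the Jacobian $J_H$ lies in $L^1_{\mathrm{loc}}(U)$, and the quasiconformal dilatation $K_H(x,y)=\inf\{K\ge 1: \|DH(x,y)\|^2\le K J_H(x,y)\}$ (with $\|DH\|$ the operator norm of the differential matrix) is finite a.e. in $U$. It has exponentially integrable distortion if moreover $\int_U e^{pK_H}\,d\sigma<\infty$ for some $p>0$, where $\sigma$ is the spherical measure, $d\sigma=\frac{4\,dx\,dy}{(1+x^2+y^2)^2}$.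 An extension of $h$ to a homeomorphism of $\mathbb{D}$ is a homeomorphism $H\colon\overline{\mathbb{D}}\to\overline{\mathbb{D}}$ with $H(\mathbb{D})=\mathbb{D}$ and $H|_{S^1}=h$; the distortion condition refers to $H|_{\mathbb{D}}$. *)

theory Defs
  imports "HOL-Analysis.Analysis" "HOL-Complex_Analysis.Winding_Numbers"
begin

text \<open>
  The plane \<open>\<real>\<^sup>2\<close> is rendered as the type \<^typ>\<open>complex\<close>, with \<open>x = Re z\<close>, \<open>y = Im z\<close>;
  Lebesgue measure on \<^typ>\<open>complex\<close> is then \<open>dx dy\<close>.
\<close>

section \<open>Circle homeomorphisms and their distortion\<close>

text \<open>
  The function \<open>g\<close> is a lift of \<open>h\<close> under the covering \<open>\<theta> \<mapsto> e\<^bsup>i\<theta>\<^esup>\<close>; orientation is preserved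
  iff lifts are increasing.
\<close>

definition circle_homeo_pres :: "(complex \<Rightarrow> complex) \<Rightarrow> bool" where
  "circle_homeo_pres h \<longleftrightarrow>
     (\<exists>k. homeomorphism (sphere 0 1) (sphere 0 1) h k) \<and>
     (\<exists>g :: real \<Rightarrow> real. continuous_on UNIV g \<and> strict_mono g \<and>
        (\<forall>\<theta>. h (cis \<theta>) = cis (g \<theta>)))"

text \<open>
  For \<open>a\<close>, \<open>b\<close> on the unit circle, \<open>b = a * cis s\<close> for exactly one \<open>s \<in> [0, 2\<pi>)\<close>, namely
  \<open>s = Arg2pi (b / a)\<close>, and the arc run through from \<open>a\<close> to \<open>b\<close> in the positive direction has
  length \<open>s\<close>.
\<close>

definition arc_len :: "complex \<Rightarrow> complex \<Rightarrow> real" where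
  "arc_len a b = Arg2pi (b / a)"

definition circ_distortion :: "(complex \<Rightarrow> complex) \<Rightarrow> real \<Rightarrow> real \<Rightarrow> real" where
  "circ_distortion h \<theta> t =
     max (arc_len (h (cis \<theta>)) (h (cis (\<theta> + t))) / arc_len (h (cis (\<theta> - t))) (h (cis \<theta>)))
         (arc_len (h (cis (\<theta> - t))) (h (cis \<theta>)) / arc_len (h (cis \<theta>)) (h (cis (\<theta> + t))))"

section \<open>Orientation-preserving homeomorphisms between planar open sets\<close>

text \<open>Orientation is preserved iff the local degree, expressed by a winding number, is \<open>+1\<close>
  at every point.\<close>

definition planar_homeo_pres :: "complex set \<Rightarrow> complex set \<Rightarrow> (complex \<Rightarrow> complex) \<Rightarrow> bool" where
  "planar_homeo_pres U V H \<longleftrightarrow>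
     open U \<and> open V \<and> (\<exists>G. homeomorphism U V H G) \<and>
     (\<forall>z r. 0 < r \<and> cball z r \<subseteq> U \<longrightarrow> winding_number (H \<circ> circlepath z r) (H z) = 1)"

section \<open>Local Sobolev regularity\<close>

primrec Ck :: "nat \<Rightarrow> (complex \<Rightarrow> real) \<Rightarrow> bool" where
  "Ck 0 \<phi> \<longleftrightarrow> continuous_on UNIV \<phi>"
| "Ck (Suc k) \<phi> \<longleftrightarrow>
     (\<forall>z. \<phi> differentiable at z) \<and> (\<forall>v. Ck k (\<lambda>z. frechet_derivative \<phi> (at z) v))"

definition test_function :: "complex set \<Rightarrow> (complex \<Rightarrow> real) \<Rightarrow> bool" where
  "test_function U \<phi> \<longleftrightarrow>
     (\<forall>k. Ck k \<phi>) \<and> (\<exists>C. compact C \<and> C \<subseteq> U \<and> (\<forall>z. z \<notin> C \<longrightarrow> \<phi> z = 0))"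

definition L1_loc :: "complex set \<Rightarrow> (complex \<Rightarrow> 'a::euclidean_space) \<Rightarrow> bool" where
  "L1_loc U f \<longleftrightarrow> (\<forall>C. compact C \<and> C \<subseteq> U \<longrightarrow> f absolutely_integrable_on C)"

definition weak_partial ::
    "complex set \<Rightarrow> complex \<Rightarrow> (complex \<Rightarrow> complex) \<Rightarrow> (complex \<Rightarrow> complex) \<Rightarrow> bool" where
  "weak_partial U v f g \<longleftrightarrow>
     (\<forall>\<phi>. test_function U \<phi> \<longrightarrow>
        (LINT z:U|lebesgue. frechet_derivative \<phi> (at z) v *\<^sub>R f z) =
        - (LINT z:U|lebesgue. \<phi> z *\<^sub>R g z))"

text \<open>
  \<open>f\<close> is in the local Sobolev space \<open>W\<^bsup>1,1\<^esup>\<close> of \<open>U\<close>, and \<open>fx\<close>, \<open>fy\<close> represent its weak partial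
  derivatives. They are determined only up to null sets, so they are carried as arguments; none of
  the notions below depends on the representatives.
\<close>

definition W11_loc ::
    "complex set \<Rightarrow> (complex \<Rightarrow> complex) \<Rightarrow> (complex \<Rightarrow> complex) \<Rightarrow> (complex \<Rightarrow> complex) \<Rightarrow> bool"
  where
  "W11_loc U f fx fy \<longleftrightarrow>
     L1_loc U f \<and> L1_loc U fx \<and> L1_loc U fy \<and> weak_partial U 1 f fx \<and> weak_partial U \<i> f fy"

section \<open>Finite and exponentially integrable distortion\<close>

text \<open>In this section \<open>a\<close>, \<open>b\<close> are the columns of the differential matrix at a point, i.e. the
  values of the two partial derivatives.\<close>

definition diff_map :: "complex \<Rightarrow> complex \<Rightarrow> complex \<Rightarrow> complex" where
  "diff_map a b v = Re v *\<^sub>R a + Im v *\<^sub>R b"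

definition jac :: "complex \<Rightarrow> complex \<Rightarrow> real" where
  "jac a b = Re a * Im b - Im a * Re b"

text \<open>The value is \<open>\<infinity>\<close> if no \<open>K\<close> is admissible.\<close>

definition dilatation :: "complex \<Rightarrow> complex \<Rightarrow> ereal" where
  "dilatation a b = Inf {ereal K | K. 1 \<le> K \<and> (onorm (diff_map a b))\<^sup>2 \<le> K * jac a b}"

definition spherical_measure :: "complex measure" where
  "spherical_measure =
     density lebesgue (\<lambda>z. ennreal (4 / (1 + (Re z)\<^sup>2 + (Im z)\<^sup>2)\<^sup>2))"

definition exp_ereal :: "ereal \<Rightarrow> ennreal" where
  "exp_ereal x = (if x = \<infinity> then \<infinity> else if x = -\<infinity> then 0 else ennreal (exp (real_of_ereal x)))"

definition finite_distortion_with ::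
    "complex set \<Rightarrow> complex set \<Rightarrow> (complex \<Rightarrow> complex) \<Rightarrow>
     (complex \<Rightarrow> complex) \<Rightarrow> (complex \<Rightarrow> complex) \<Rightarrow> bool" where
  "finite_distortion_with U V H Hx Hy \<longleftrightarrow>
     planar_homeo_pres U V H \<and>
     W11_loc U H Hx Hy \<and>
     L1_loc U (\<lambda>z. jac (Hx z) (Hy z)) \<and>
     (AE z in lebesgue. z \<in> U \<longrightarrow> dilatation (Hx z) (Hy z) < \<infinity>)"

definition finite_distortion ::
    "complex set \<Rightarrow> complex set \<Rightarrow> (complex \<Rightarrow> complex) \<Rightarrow> bool" where
  "finite_distortion U V H \<longleftrightarrow> (\<exists>Hx Hy. finite_distortion_with U V H Hx Hy)"

definition exp_integrable_distortion ::
    "complex set \<Rightarrow> complex set \<Rightarrow> (complex \<Rightarrow> complex) \<Rightarrow> bool" where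
  "exp_integrable_distortion U V H \<longleftrightarrow>
     (\<exists>Hx Hy. finite_distortion_with U V H Hx Hy \<and>
        (\<exists>p::real. 0 < p \<and>
           (\<integral>\<^sup>+z\<in>U. exp_ereal (ereal p * dilatation (Hx z) (Hy z)) \<partial>spherical_measure) < \<infinity>))"

section \<open>Extension to the disk\<close>

definition disk_extension :: "(complex \<Rightarrow> complex) \<Rightarrow> (complex \<Rightarrow> complex) \<Rightarrow> bool" where
  "disk_extension h H \<longleftrightarrow>
     (\<exists>G. homeomorphism (cball 0 1) (cball 0 1) H G) \<and>
     H ` ball 0 1 = ball 0 1 \<and>
     (\<forall>z \<in> sphere 0 1. H z = h z)"

end

theory Submission
  imports Defs
begin

text \<open>
  Lift \<open>h\<close> to an increasing homeomorphism \<open>g\<close> of the line with \<open>g (x + 2\<pi>) = g x + 2\<pi>\<close>. The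
  extension is the Beurling--Ahlfors extension of \<open>g\<close> to the upper half plane, carried to the disk
  by \<open>z = exp (\<i> w)\<close>. With \<open>\<alpha>(x,y)\<close> and \<open>\<beta>(x,y)\<close> the mean values of \<open>g\<close> over \<open>[x, x+y]\<close> and over
  \<open>[x-y, x]\<close>, it is \<open>F(x + iy) = (\<alpha>+\<beta>)/2 + i(\<alpha>-\<beta>)\<close>, and the disk map is \<open>H(exp (\<i> w)) = exp (\<i> F(w))\<close>,
  which is well defined since \<open>F(w + 2\<pi>) = F(w) + 2\<pi>\<close>.
  
  \<^item> \<open>F\<close> is injective because \<open>\<alpha>\<close> increases in \<open>x\<close> and in \<open>y\<close>, while \<open>\<beta>\<close> increases in \<open>x\<close> and
    decreases in \<open>y\<close> (\<open>BA_inj\<close>). Invariance of domain then makes \<open>H\<close> a homeomorphism of the closed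
    disk. Its local degree is the degree of \<open>h\<close>, as circles inside the disk can be moved to the unit
    circle (\<open>winding_number_disk_ext\<close>).
  
  \<^item> \<open>F\<close> is continuously differentiable with positive Jacobian for \<open>y > 0\<close>. For large \<open>y\<close> the mean
    values of the periodic function \<open>g x - x\<close> settle down at rate \<open>1/y\<close>, so that \<open>F\<close> and its
    derivative approach a translation (\<open>BA_asymptotics\<close>), and \<open>H\<close> is continuously differentiable with
    positive Jacobian also at the origin (\<open>disk_ext_C1\<close>). Hence \<open>H\<close> has finite distortion, and its
    dilatation is bounded on compact subsets of the open disk.
  
  \<^item> Near the boundary circle, the dilatation at \<open>x + iy\<close> is at most \<open>56\<close> times the largest of the
    three quotients \<open>\<rho>(x, y)\<close>, \<open>\<rho>(x - y/4, 3y/4)\<close>, \<open>\<rho>(x + y/4, 3y/4)\<close>, where \<open>\<rho>\<close> is the symmetric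
    distortion (\<open>frob_dilatation_BA_le\<close>). It matters that this bound is linear in \<open>\<rho>\<close>: the obvious
    estimate gives a product of two values of \<open>\<rho>\<close>, whose exponential need not be integrable. The
    exponential of the maximum is at most the sum of three exponentials, and the three integrals are
    compared with the given one by the shears \<open>(x, y) \<mapsto> (x \<plusminus> y/4, 3y/4)\<close>.
  
  \<^item> The passage from the half plane to the disk costs nothing, since \<open>w \<mapsto> exp (\<i> w)\<close> is conformal
    and contracts area for \<open>Im w > 0\<close> (\<open>nn_integral_polar_le\<close>).
\<close>


section \<open>Weak derivatives and dilatation of continuously differentiable maps\<close>

lemma integrable_continuous_compact_support:
  fixes f :: "complex \<Rightarrow> 'a::{banach, second_countable_topology}"
  assumes "continuous_on UNIV f" "compact C" "\<And>z. z \<notin> C \<Longrightarrow> f z = 0"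
  shows "integrable lborel f"
proof -
  have "integrable lborel (\<lambda>z. indicator C z *\<^sub>R f z)"
    using assms by (intro borel_integrable_compact continuous_on_subset[OF assms(1)]) auto
  also have "(\<lambda>z. indicator C z *\<^sub>R f z) = f"
    using assms(3) by (auto simp: fun_eq_iff indicator_def)
  finally show ?thesis .
qed

lemma has_derivative_zero_outside_support:
  fixes f :: "complex \<Rightarrow> 'a::real_normed_vector"
  assumes "compact C" "\<And>z. z \<notin> C \<Longrightarrow> f z = 0" "z \<notin> C"
  shows "(f has_derivative (\<lambda>_. 0)) (at z)"
proof -
  have "open (- C)" using assms(1) by (simp add: compact_imp_closed open_Compl)
  have "((\<lambda>_. 0::'a) has_derivative (\<lambda>_. 0)) (at z)" by simp
  then show ?thesis
    by (rule has_derivative_transform_within_open[OF _ \<open>open (- C)\<close>]) (use assms in auto)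
qed

lemma continuous_on_extend_zero:
  fixes f :: "complex \<Rightarrow> 'a::real_normed_vector"
  assumes "open U" "continuous_on U f" "compact C" "C \<subseteq> U" "\<And>z. z \<notin> C \<Longrightarrow> f z = 0"
  shows "continuous_on UNIV f"
proof -
  have "open (- C)" using assms(3) by (simp add: compact_imp_closed open_Compl)
  have "continuous_on (- C) f"
    using assms(5) by (subst continuous_on_cong[where g="\<lambda>_. 0"]) auto
  then have "continuous_on (U \<union> - C) f"
    using assms \<open>open (- C)\<close> by (intro continuous_on_open_Un) auto
  moreover have "U \<union> - C = UNIV" using assms by auto
  ultimately show ?thesis by simp
qed

text \<open>
  Translation invariance of the Lebesgue measure makes the integral of every difference quotient
  vanish; the quotients converge boundedly on a common compact set.
\<close>

lemma integral_directional_derivative_eq_0: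
  fixes \<psi> :: "complex \<Rightarrow> complex"
  assumes der: "\<And>z. (\<psi> has_derivative D z) (at z)"
    and cont: "continuous_on UNIV (\<lambda>z. D z v)"
    and C: "compact C" "\<And>z. z \<notin> C \<Longrightarrow> \<psi> z = 0"
  shows "(LINT z|lborel. D z v) = 0"
proof -
  have D0: "D z v = 0" if "z \<notin> C" for z
    using has_derivative_unique[OF der has_derivative_zero_outside_support[OF C that]] by simp
  have c\<psi>: "continuous_on UNIV \<psi>"
    using der by (auto intro!: has_derivative_continuous continuous_at_imp_continuous_on)
  have lin: "D z (t *\<^sub>R u) = t *\<^sub>R D z u" for z t u
    using has_derivative_bounded_linear[OF der[of z]] by (simp add: bounded_linear.linear linear_scale)
  obtain M where M: "\<And>z. norm (D z v) \<le> M"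
  proof -
    have "compact ((\<lambda>z. D z v) ` C)" using C cont by (intro compact_continuous_image continuous_on_subset[OF cont]) auto
    then obtain M where M: "\<And>z. z \<in> C \<Longrightarrow> norm (D z v) \<le> M"
      by (metis bounded_iff compact_imp_bounded imageI)
    show ?thesis
      by (rule that[of "max M 0"]) (metis D0 M max.coboundedI1 max.cobounded2 norm_zero)
  qed
  have "M \<ge> 0" using M[of 0] norm_ge_zero order_trans by blast
  define f where "f n z = (\<psi> (z + (1 / real (Suc n)) *\<^sub>R v) - \<psi> z) * of_nat (Suc n)" for n z
  \<comment> \<open>Contains every point that a shift by at most \<open>v\<close> can move into \<open>C\<close>; the support of all \<open>f n\<close>.\<close>
  define C' where "C' = (\<lambda>p. fst p - snd p) ` (C \<times> (\<lambda>t. t *\<^sub>R v) ` {0..1::real}) "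
  have C': "compact C'" unfolding C'_def
    by (intro compact_continuous_image compact_Times C continuous_intros) auto
  have cont_f: "continuous_on UNIV (f n)" for n
    unfolding f_def by (intro continuous_intros continuous_on_compose2[OF c\<psi>]) auto
  have bound: "norm (f n z) \<le> M * indicator C' z" for n z
  proof (cases "z \<in> C'")
    case True
    let ?e = "1 / real (Suc n)"
    have "norm (\<psi> (z + ?e *\<^sub>R v) - \<psi> (z + 0 *\<^sub>R v)) \<le> M * norm (?e - 0)"
    proof (rule differentiable_bound[of "{0..?e}" "\<lambda>t. \<psi> (z + t *\<^sub>R v)" "\<lambda>t s. D (z + t *\<^sub>R v) (s *\<^sub>R v)"])
      show "((\<lambda>t. \<psi> (z + t *\<^sub>R v)) has_derivative (\<lambda>s. D (z + t *\<^sub>R v) (s *\<^sub>R v))) (at t within {0..?e})" for t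
        by (rule has_derivative_compose[OF _ der]) (auto intro!: derivative_eq_intros)
      show "onorm (\<lambda>s. D (z + t *\<^sub>R v) (s *\<^sub>R v)) \<le> M" for t
        by (rule onorm_le) (use M in \<open>simp add: lin mult.commute[of M] mult_left_mono\<close>)
    qed auto
    then have "norm (\<psi> (z + ?e *\<^sub>R v) - \<psi> z) * real (Suc n) \<le> M"
      by (simp add: field_simps)
    then show ?thesis using True by (simp add: f_def norm_mult del: of_nat_Suc)
  next
    case False
    have "z \<notin> C" using False by (force simp: C'_def intro: image_eqI[of _ _ "(z, 0)"])
    moreover have "z + (1 / real (Suc n)) *\<^sub>R v \<notin> C"
    proof
      assume "z + (1 / real (Suc n)) *\<^sub>R v \<in> C"
      then have "z \<in> C'" unfolding C'_def
        by (intro image_eqI[of _ _ "(z + (1 / real (Suc n)) *\<^sub>R v, (1 / real (Suc n)) *\<^sub>R v)"]) (auto simp del: of_nat_Suc)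
      with False show False ..
    qed
    ultimately show ?thesis using False C(2) by (simp add: f_def)
  qed
  have int\<psi>: "integrable lborel \<psi>" by (rule integrable_continuous_compact_support[OF c\<psi> C])
  have zero: "(LINT z|lborel. f n z) = 0" for n
  proof -
    let ?c = "(1 / real (Suc n)) *\<^sub>R v"
    have m: "\<psi> \<in> borel_measurable borel" using c\<psi> by (rule borel_measurable_continuous_onI)
    have "(LINT z|lborel. \<psi> z) = (LINT z|distr lborel borel ((+) ?c). \<psi> z)" by (simp only: lborel_distr_plus)
    also have "\<dots> = (LINT z|lborel. \<psi> (?c + z))" using m by (subst integral_distr) auto
    finally have eq: "(LINT z|lborel. \<psi> (z + ?c)) = (LINT z|lborel. \<psi> z)" by (simp add: add.commute)
    have "integrable (distr lborel borel ((+) ?c)) \<psi>" using int\<psi> by (simp only: lborel_distr_plus)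
    then have "integrable lborel (\<lambda>z. \<psi> (z + ?c))"
      using m by (subst (asm) integrable_distr_eq) (auto simp: add.commute)
    then show ?thesis unfolding f_def using int\<psi> eq by simp
  qed
  have "(\<lambda>n. LINT z|lborel. f n z) \<longlonglongrightarrow> (LINT z|lborel. D z v)"
  proof (rule integral_dominated_convergence)
    show "integrable lborel (\<lambda>z. M * indicator C' z)"
      using C' emeasure_compact_finite[OF C'] by (intro integrable_mult_right) (auto simp: compact_imp_closed)
    show "AE z in lborel. (\<lambda>n. f n z) \<longlonglongrightarrow> D z v"
    proof (rule AE_I2)
      fix z
      have "((\<lambda>t. \<psi> (z + t *\<^sub>R v)) has_derivative (\<lambda>s. D (z + 0 *\<^sub>R v) (s *\<^sub>R v))) (at 0)"
        by (rule has_derivative_compose[OF _ der]) (auto intro!: derivative_eq_intros)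
      then have vd: "((\<lambda>t. \<psi> (z + t *\<^sub>R v)) has_vector_derivative D z v) (at 0)"
        by (simp add: has_vector_derivative_def lin)
      have lim: "((\<lambda>t. (\<psi> (z + t *\<^sub>R v) - \<psi> z) /\<^sub>R t) \<longlongrightarrow> D z v) (at 0)"
      proof -
        let ?q = "\<lambda>t. (\<psi> (z + t *\<^sub>R v) - \<psi> z) /\<^sub>R t"
        have "((\<lambda>t. norm (\<psi> (z + t *\<^sub>R v) - \<psi> z - t *\<^sub>R D z v) / \<bar>t\<bar>) \<longlongrightarrow> 0) (at 0)"
          using vd by (simp add: has_vector_derivative_def has_derivative_at)
        moreover have "\<forall>\<^sub>F t in at 0. norm (\<psi> (z + t *\<^sub>R v) - \<psi> z - t *\<^sub>R D z v) / \<bar>t\<bar> = norm (?q t - D z v)"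
        proof -
          have "norm (w - t *\<^sub>R D z v) / \<bar>t\<bar> = norm (w /\<^sub>R t - D z v)" if "t \<noteq> 0" for w and t :: real
          proof -
            have "w /\<^sub>R t - D z v = (w - t *\<^sub>R D z v) /\<^sub>R t" using that by (simp add: scaleR_diff_right)
            then show ?thesis by (simp add: divide_inverse mult.commute)
          qed
          then show ?thesis by (auto simp: eventually_at intro: exI[of _ 1])
        qed
        ultimately have "((\<lambda>t. norm (?q t - D z v)) \<longlongrightarrow> 0) (at 0)"
          by (rule Lim_transform_eventually)
        then show ?thesis by (simp add: tendsto_norm_zero_iff LIM_zero_iff)
      qed
      have "filterlim (\<lambda>n. 1 / real (Suc n)) (at 0) sequentially"
        using LIMSEQ_inverse_real_of_nat by (auto simp: filterlim_at inverse_eq_divide)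
      from filterlim_compose[OF lim this] show "(\<lambda>n. f n z) \<longlonglongrightarrow> D z v"
        by (simp add: f_def scaleR_conv_of_real mult.commute del: of_nat_Suc)
    qed
    show "AE z in lborel. norm (f n z) \<le> M * indicator C' z" for n using bound by auto
    show "f n \<in> borel_measurable lborel" for n using cont_f borel_measurable_continuous_onI by auto
    show "(\<lambda>z. D z v) \<in> borel_measurable lborel" using cont borel_measurable_continuous_onI by auto
  qed
  with zero show ?thesis by (simp add: LIMSEQ_const_iff)
qed

text \<open>
  Integration by parts: the product \<open>\<phi> f\<close>, continued by zero, is continuously differentiable on the
  whole plane and has compact support, so the integral of its derivative vanishes.
\<close>

lemma weak_partial_of_continuous_derivative:
  assumes U: "open U"
    and der: "\<And>z. z \<in> U \<Longrightarrow> (f has_derivative D z) (at z)"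
    and cont: "continuous_on U (\<lambda>z. D z v)"
  shows "weak_partial U v f (\<lambda>z. D z v)"
  unfolding weak_partial_def
proof (intro allI impI)
  fix \<phi> assume \<phi>: "test_function U \<phi>"
  then obtain C where C: "compact C" "C \<subseteq> U" "\<And>z. z \<notin> C \<Longrightarrow> \<phi> z = 0"
    unfolding test_function_def by blast
  define d where "d z = frechet_derivative \<phi> (at z)" for z
  have "Ck 1 \<phi>" using \<phi> unfolding test_function_def by blast
  then have d: "(\<phi> has_derivative d z) (at z)" and dc: "continuous_on UNIV (\<lambda>z. d z v)" for z
    by (auto simp: d_def frechet_derivative_works)
  have d0: "d z = (\<lambda>_. 0)" if "z \<notin> C" for z
    using has_derivative_unique[OF d has_derivative_zero_outside_support[OF C(1,3) that]] by simp
  have c\<phi>: "continuous_on S \<phi>" for S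
    using d by (auto intro!: has_derivative_continuous continuous_at_imp_continuous_on)
  have cf: "continuous_on U f"
    using der U by (auto intro!: has_derivative_continuous continuous_at_imp_continuous_on)
  define \<psi> where "\<psi> z = indicator U z *\<^sub>R (\<phi> z *\<^sub>R f z)" for z
  define G1 where "G1 z = indicator U z *\<^sub>R (d z v *\<^sub>R f z)" for z
  define G2 where "G2 z = indicator U z *\<^sub>R (\<phi> z *\<^sub>R D z v)" for z
  define D' where "D' z u = indicator U z *\<^sub>R (\<phi> z *\<^sub>R D z u + d z u *\<^sub>R f z)" for z u
  have "continuous_on U G1"
    by (subst continuous_on_cong[OF refl, where g="\<lambda>z. d z v *\<^sub>R f z"])
       (auto simp: G1_def intro!: continuous_intros cf continuous_on_subset[OF dc])
  then have G1: "continuous_on UNIV G1"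
    by (rule continuous_on_extend_zero[OF U _ C(1,2)]) (auto simp: G1_def d0)
  have "continuous_on U G2"
    by (subst continuous_on_cong[OF refl, where g="\<lambda>z. \<phi> z *\<^sub>R D z v"])
       (auto simp: G2_def intro!: continuous_intros cont c\<phi>)
  then have G2: "continuous_on UNIV G2"
    by (rule continuous_on_extend_zero[OF U _ C(1,2)]) (auto simp: G2_def C)
  have I1: "integrable lborel G1" by (rule integrable_continuous_compact_support[OF G1 C(1)]) (auto simp: G1_def d0)
  have I2: "integrable lborel G2" by (rule integrable_continuous_compact_support[OF G2 C(1)]) (auto simp: G2_def C)
  have D'_eq: "D' z v = G2 z + G1 z" for z by (simp add: D'_def G1_def G2_def scaleR_add_right)
  have "(LINT z|lborel. D' z v) = 0"
  proof (rule integral_directional_derivative_eq_0)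
    show "(\<psi> has_derivative D' z) (at z)" for z
    proof (cases "z \<in> U")
      case True
      have "((\<lambda>z. \<phi> z *\<^sub>R f z) has_derivative (\<lambda>u. \<phi> z *\<^sub>R D z u + d z u *\<^sub>R f z)) (at z)"
        by (rule has_derivative_scaleR[OF d der[OF True]])
      then have "(\<psi> has_derivative (\<lambda>u. \<phi> z *\<^sub>R D z u + d z u *\<^sub>R f z)) (at z)"
        by (rule has_derivative_transform_within_open[OF _ U True]) (auto simp: \<psi>_def)
      then show ?thesis using True by (simp add: D'_def[abs_def])
    next
      case False
      then have "(\<psi> has_derivative (\<lambda>_. 0)) (at z)"
        using C by (intro has_derivative_zero_outside_support[OF C(1)]) (auto simp: \<psi>_def)
      then show ?thesis using False by (simp add: D'_def[abs_def])
    qed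
    show "continuous_on UNIV (\<lambda>z. D' z v)" unfolding D'_eq by (intro continuous_intros G1 G2)
  qed (use C in \<open>auto simp: \<psi>_def\<close>)
  then have "(LINT z|lborel. G1 z) = - (LINT z|lborel. G2 z)"
    unfolding D'_eq using I1 I2 by (simp add: add_eq_0_iff)
  moreover have "(LINT z|lborel. G1 z) = (LINT z|lebesgue. G1 z)" "(LINT z|lborel. G2 z) = (LINT z|lebesgue. G2 z)"
    using I1 I2 by (auto simp: integral_completion)
  ultimately show "(LINT z:U|lebesgue. frechet_derivative \<phi> (at z) v *\<^sub>R f z) =
    - (LINT z:U|lebesgue. \<phi> z *\<^sub>R D z v)"
    by (simp add: set_lebesgue_integral_def G1_def[abs_def] G2_def[abs_def] d_def)
qed

lemma L1_loc_continuous: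
  assumes "continuous_on U f" shows "L1_loc U f"
  unfolding L1_loc_def
proof (intro allI impI)
  fix C :: "complex set" assume C: "compact C \<and> C \<subseteq> U"
  then have "set_integrable lborel C f"
    unfolding set_integrable_def
    by (intro borel_integrable_compact continuous_on_subset[OF assms]) auto
  then show "f absolutely_integrable_on C"
    unfolding set_integrable_def by (auto simp: integrable_completion)
qed

lemma W11_loc_of_continuous_derivative:
  assumes "open U"
    and "\<And>z. z \<in> U \<Longrightarrow> (f has_derivative diff_map (fx z) (fy z)) (at z)"
    and "continuous_on U fx" "continuous_on U fy"
  shows "W11_loc U f fx fy"
proof -
  have "continuous_on U f"
    using assms by (auto intro!: has_derivative_continuous continuous_at_imp_continuous_on)
  moreover have "weak_partial U 1 f fx" "weak_partial U \<i> f fy"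
    using weak_partial_of_continuous_derivative[OF assms(1,2), where v=1]
      weak_partial_of_continuous_derivative[OF assms(1,2), where v=\<i>] assms(3,4)
    by (simp_all add: diff_map_def)
  ultimately show ?thesis
    using assms by (simp add: W11_loc_def L1_loc_continuous)
qed

text \<open>
  The Hilbert--Schmidt norm in place of the operator norm gives an upper bound for the dilatation
  (by a factor of at most \<open>2\<close>) that is a rational expression in the partial derivatives.
\<close>

definition frob_dilatation :: "complex \<Rightarrow> complex \<Rightarrow> real" where
  "frob_dilatation a b = ((norm a)\<^sup>2 + (norm b)\<^sup>2) / jac a b"

lemma dilatation_le_frob_dilatation:
  assumes "0 < jac a b"
  shows "dilatation a b \<le> ereal (frob_dilatation a b)"
proof -
  have "onorm (diff_map a b) \<le> sqrt ((norm a)\<^sup>2 + (norm b)\<^sup>2)"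
  proof (rule onorm_le)
    fix v
    have "norm (diff_map a b v) \<le> \<bar>Re v\<bar> * norm a + \<bar>Im v\<bar> * norm b"
      unfolding diff_map_def by (metis norm_scaleR norm_triangle_ineq)
    also have "\<dots> \<le> sqrt ((norm a)\<^sup>2 + (norm b)\<^sup>2) * norm v"
    proof (rule power2_le_imp_le)
      have "0 \<le> (\<bar>Re v\<bar> * norm b - \<bar>Im v\<bar> * norm a)\<^sup>2" by simp
      then show "(\<bar>Re v\<bar> * norm a + \<bar>Im v\<bar> * norm b)\<^sup>2 \<le> (sqrt ((norm a)\<^sup>2 + (norm b)\<^sup>2) * norm v)\<^sup>2"
        by (simp add: power_mult_distrib cmod_power2 power2_sum power2_diff algebra_simps)
    qed auto
    finally show "norm (diff_map a b v) \<le> sqrt ((norm a)\<^sup>2 + (norm b)\<^sup>2) * norm v" .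
  qed
  moreover have "0 \<le> onorm (diff_map a b)"
  proof -
    have "bounded_linear (diff_map a b)" unfolding diff_map_def[abs_def]
      by (intro bounded_linear_add bounded_linear_scaleR_const bounded_linear_Re bounded_linear_Im)
    then show ?thesis by (rule onorm_pos_le)
  qed
  ultimately have "(onorm (diff_map a b))\<^sup>2 \<le> (sqrt ((norm a)\<^sup>2 + (norm b)\<^sup>2))\<^sup>2"
    by (rule power_mono)
  then have "(onorm (diff_map a b))\<^sup>2 \<le> frob_dilatation a b * jac a b"
    using assms by (simp add: frob_dilatation_def)
  moreover have "1 \<le> frob_dilatation a b"
  proof -
    have "0 \<le> (Re a - Im b)\<^sup>2 + (Im a + Re b)\<^sup>2" by simp
    then have "2 * jac a b \<le> (norm a)\<^sup>2 + (norm b)\<^sup>2"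
      by (simp add: jac_def cmod_power2 power2_sum power2_diff algebra_simps)
    then show ?thesis using assms by (simp add: frob_dilatation_def)
  qed
  ultimately show ?thesis unfolding dilatation_def by (intro Inf_lower) auto
qed

section \<open>Integration in polar coordinates\<close>

lemma lborel_complex_real_pair:
  "distr (lborel \<Otimes>\<^sub>M lborel) borel (\<lambda>p. Complex (fst p) (snd p)) = (lborel :: complex measure)"
proof (rule lborel_eqI[symmetric])
  fix l u :: complex
  assume lu: "\<And>b. b \<in> Basis \<Longrightarrow> l \<bullet> b \<le> u \<bullet> b"
  have le: "Re l \<le> Re u" "Im l \<le> Im u" using lu[of 1] lu[of \<i>] by (auto simp: Basis_complex_def)
  have meas: "(\<lambda>p. Complex (fst p) (snd p)) \<in> borel_measurable (borel :: (real \<times> real) measure)"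
    by (intro borel_measurable_continuous_onI continuous_intros)
  then have meas': "(\<lambda>p. Complex (fst p) (snd p)) \<in> measurable (lborel \<Otimes>\<^sub>M lborel) borel"
    by (simp add: lborel_prod)
  have pre: "(\<lambda>p. Complex (fst p) (snd p)) -` box l u = box (Re l) (Re u) \<times> box (Im l) (Im u)"
    by (auto simp: box_def Basis_complex_def)
  show "emeasure (distr (lborel \<Otimes>\<^sub>M lborel) borel (\<lambda>p. Complex (fst p) (snd p))) (box l u) =
        ennreal (prod ((\<bullet>) (u - l)) Basis)"
    using le by (simp add: emeasure_distr[OF meas'] pre space_pair_measure
        lborel.emeasure_pair_measure_Times Basis_complex_def ennreal_mult)
qed simp

lemma nn_integral_complex_iterated:
  assumes [measurable]: "f \<in> borel_measurable (borel :: complex measure)"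
  shows "(\<integral>\<^sup>+z. f z \<partial>lborel) = (\<integral>\<^sup>+x. \<integral>\<^sup>+y. f (Complex x y) \<partial>lborel \<partial>lborel)"
proof -
  have meas: "(\<lambda>p. Complex (fst p) (snd p)) \<in> borel_measurable (borel :: (real \<times> real) measure)"
    by (intro borel_measurable_continuous_onI continuous_intros)
  then have meas'[measurable]: "(\<lambda>p. Complex (fst p) (snd p)) \<in> measurable (lborel \<Otimes>\<^sub>M lborel) borel"
    by (simp add: lborel_prod)
  have "(\<integral>\<^sup>+z. f z \<partial>lborel) = (\<integral>\<^sup>+p. f (Complex (fst p) (snd p)) \<partial>(lborel \<Otimes>\<^sub>M lborel))"
    by (subst lborel_complex_real_pair[symmetric]) (simp add: nn_integral_distr)
  also have "\<dots> = (\<integral>\<^sup>+x. \<integral>\<^sup>+y. f (Complex x y) \<partial>lborel \<partial>lborel)"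
    by (subst lborel.nn_integral_fst[symmetric]) auto
  finally show ?thesis .
qed

text \<open>
  The isometry to the complex plane from the vector model of the plane, in which maps have Jacobian
  determinants.
\<close>

definition complex_of_vec :: "real^2 \<Rightarrow> complex" where
  "complex_of_vec v = Complex (v$1) (v$2)"

lemma continuous_complex_of_vec [continuous_intros]:
  "continuous_on S complex_of_vec"
  unfolding complex_of_vec_def by (intro continuous_intros)

lemma complex_of_vec_measurable [measurable]: "complex_of_vec \<in> borel_measurable borel"
  by (intro borel_measurable_continuous_onI continuous_complex_of_vec)

lemma lborel_complex_of_vec: "distr lborel borel complex_of_vec = (lborel :: complex measure)"
proof (rule lborel_eqI[symmetric])
  fix l u :: complex
  assume lu: "\<And>b. b \<in> Basis \<Longrightarrow> l \<bullet> b \<le> u \<bullet> b"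
  have le: "Re l \<le> Re u" "Im l \<le> Im u" using lu[of 1] lu[of \<i>] by (auto simp: Basis_complex_def)
  have pre: "complex_of_vec -` box l u = box (vector [Re l, Im l]) (vector [Re u, Im u])"
    by (auto simp: mem_box_cart in_box_complex_iff complex_of_vec_def forall_2)
  have B: "(Basis :: (real^2) set) = {axis 1 1, axis 2 1}"
    by (auto simp: Basis_vec_def UNIV_2)
  have ne: "axis 1 1 \<noteq> (axis 2 1 :: real^2)" by (simp add: axis_eq_axis)
  show "emeasure (distr lborel borel complex_of_vec) (box l u) = ennreal (prod ((\<bullet>) (u - l)) Basis)"
    using le ne
    by (simp add: emeasure_distr pre emeasure_lborel_box_eq B inner_axis Basis_complex_def)
qed simp

text \<open>
  In the coordinates \<open>z = exp (\<i> w)\<close> the Jacobian is \<open>exp (- 2 y) \<le> 1\<close>, where \<open>y = Im w > 0\<close>. An inequality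
  between measures needs only that the strip covers the annulus, so the overlap of its two vertical
  sides is harmless.
\<close>

lemma emeasure_polar_image_le:
  assumes B: "B \<in> sets borel" and Bsub: "B \<subseteq> {z. exp (- Y) < norm z \<and> norm z < 1}"
  shows "emeasure lborel B \<le>
    emeasure lborel {w. Re w \<in> {0..2*pi} \<and> Im w \<in> {0<..<Y} \<and> exp (\<i> * w) \<in> B}"
proof -
  define P :: "real^2 \<Rightarrow> real^2" where
    "P v = vector [exp (- v$2) * cos (v$1), exp (- v$2) * sin (v$1)]" for v
  define P' :: "real^2 \<Rightarrow> real^2 \<Rightarrow> real^2" where
    "P' v u = vector [exp (- v$2) * (- u$2 * cos (v$1) - u$1 * sin (v$1)),
                      exp (- v$2) * (- u$2 * sin (v$1) + u$1 * cos (v$1))]" for v u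
  define E where "E = {w. Re w \<in> {0..2*pi} \<and> Im w \<in> {0<..<Y} \<and> exp (\<i> * w) \<in> B}"
  define S where "S = complex_of_vec -` E"
  have P_exp: "complex_of_vec (P v) = exp (\<i> * complex_of_vec v)" for v
    by (simp add: complex_of_vec_def P_def complex_eq_iff Re_exp Im_exp)
  have [measurable]: "(\<lambda>w::complex. exp (\<i> * w)) \<in> borel_measurable borel"
    by (intro borel_measurable_continuous_onI continuous_intros)
  have [measurable]: "B \<in> sets borel" by fact
  have E [measurable]: "E \<in> sets borel" unfolding E_def by measurable
  have S [measurable]: "S \<in> sets borel" unfolding S_def using measurable_sets_borel[OF complex_of_vec_measurable E] by simp
  have bS: "S \<subseteq> cbox (vector [0,0]) (vector [2*pi, Y])"
    by (auto simp: S_def E_def mem_box_cart complex_of_vec_def forall_2)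
  then have "bounded S" using bounded_cbox bounded_subset by blast
  then have Sm: "S \<in> lmeasurable"
    using S by (intro bounded_set_imp_lmeasurable) auto
  have deriv: "(P has_derivative P' v) (at v within S)" for v
  proof -
    have P_eq: "P = (\<lambda>v. (exp (- v$2) * cos (v$1)) *\<^sub>R axis 1 1 + (exp (- v$2) * sin (v$1)) *\<^sub>R axis 2 1)"
      by (auto simp: P_def fun_eq_iff vec_eq_iff forall_2 axis_def)
    have P'_eq: "P' v = (\<lambda>u. (exp (- v$2) * (- u$2 * cos (v$1) - u$1 * sin (v$1))) *\<^sub>R axis 1 1
         + (exp (- v$2) * (- u$2 * sin (v$1) + u$1 * cos (v$1))) *\<^sub>R axis 2 1)"
      by (auto simp: P'_def fun_eq_iff vec_eq_iff forall_2 axis_def)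
    have nth: "((\<lambda>v::real^2. v$i) has_derivative (\<lambda>u. u$i)) (at v within S)" for i
      by (rule bounded_linear_imp_has_derivative[OF bounded_linear_vec_nth])
    show ?thesis
      unfolding P_eq P'_eq
      by (auto intro!: derivative_eq_intros nth simp: algebra_simps fun_eq_iff)
  qed
  have det: "det (matrix (P' v)) = exp (- 2 * v$2)" for v
  proof -
    let ?e = "exp (- v$2)" and ?c = "cos (v$1)" and ?s = "sin (v$1)"
    have "det (matrix (P' v)) = ?e * ?s * (?e * ?s) + ?e * ?c * (?e * ?c)"
      by (simp add: det_2 matrix_def P'_def axis_def)
    also have "\<dots> = ?e * ?e * (?c\<^sup>2 + ?s\<^sup>2)" by algebra
    also have "\<dots> = exp (- 2 * v$2)" by (simp only: sin_cos_squared_add2 flip: exp_add) simp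
    finally show ?thesis .
  qed
  have img: "complex_of_vec -` B \<subseteq> P ` S"
  proof
    fix v assume v: "v \<in> complex_of_vec -` B"
    define z where "z = complex_of_vec v"
    have z: "z \<in> B" "exp (-Y) < norm z" "norm z < 1" using v Bsub by (auto simp: z_def)
    then have "z \<noteq> 0" by auto
    define y where "y = - ln (norm z)"
    have zpos: "norm z > 0" using \<open>z \<noteq> 0\<close> by simp
    have "ln (exp (-Y)) < ln (norm z)" using z(2) zpos by (subst ln_less_cancel_iff) auto
    then have y: "0 < y" "y < Y" using z zpos by (auto simp: y_def)
    define w where "w = Complex (Arg2pi z) y"
    have "exp (\<i> * w) = z"
    proof -
      have "\<i> * w = of_real (ln (norm z)) + \<i> * of_real (Arg2pi z)"
        by (simp add: w_def y_def complex_eq_iff)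
      then have "exp (\<i> * w) = of_real (norm z) * exp (\<i> * of_real (Arg2pi z))"
        by (simp only: exp_add exp_of_real exp_ln[OF zpos])
      then show ?thesis using Arg2pi_eq[of z] by simp
    qed
    moreover have "w \<in> E" using y z Arg2pi[of z] \<open>exp (\<i> * w) = z\<close> by (auto simp: E_def w_def intro: less_imp_le)
    moreover define s :: "real^2" where "s = vector [Re w, Im w]"
    have sw: "complex_of_vec s = w" by (simp add: s_def complex_of_vec_def)
    ultimately have "s \<in> S" "complex_of_vec (P s) = complex_of_vec v"
      by (auto simp: S_def P_exp z_def)
    then have "P s = v" by (auto simp: complex_of_vec_def vec_eq_iff forall_2)
    then show "v \<in> P ` S" using \<open>s \<in> S\<close> by blast
  qed
  have bound: "\<bar>det (matrix (P' v))\<bar> \<le> 1" if "v \<in> S" for v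
    using that by (auto simp: det S_def E_def complex_of_vec_def)
  have int: "(\<lambda>v. \<bar>det (matrix (P' v))\<bar>) integrable_on S"
  proof -
    have "continuous_on (cbox (vector [0,0]) (vector [2*pi, Y])) (\<lambda>v::real^2. \<bar>det (matrix (P' v))\<bar>)"
      unfolding det by (intro continuous_intros)
    then have "(\<lambda>v. \<bar>det (matrix (P' v))\<bar>) absolutely_integrable_on cbox (vector [0,0]) (vector [2*pi, Y])"
      by (rule absolutely_integrable_continuous)
    then have "(\<lambda>v. \<bar>det (matrix (P' v))\<bar>) absolutely_integrable_on S"
      using S bS by (rule_tac set_integrable_subset) auto
    then show ?thesis using set_lebesgue_integral_eq_integral(1) by blast
  qed
  have Pm: "P ` S \<in> lmeasurable" "measure lebesgue (P ` S) \<le> 1 * measure lebesgue S"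
    using measurable_bounded_differentiable_image[OF Sm deriv int bound]
      measure_bounded_differentiable_image[OF Sm deriv int bound] by auto
  have vB: "complex_of_vec -` B \<in> sets borel"
    using measurable_sets_borel[OF complex_of_vec_measurable B] by simp
  have 1: "emeasure lborel B = emeasure lborel (complex_of_vec -` B)"
    by (subst lborel_complex_of_vec[symmetric]) (simp add: emeasure_distr)
  have 2: "emeasure lborel E = emeasure lborel S"
    by (subst lborel_complex_of_vec[symmetric]) (simp add: emeasure_distr S_def)
  have 3: "emeasure lebesgue (complex_of_vec -` B) \<le> emeasure lebesgue (P ` S)"
    by (rule emeasure_mono[OF img fmeasurableD[OF Pm(1)]])
  have 4: "emeasure lebesgue (P ` S) \<le> emeasure lebesgue S"
    using Pm(2) by (simp add: emeasure_eq_measure2[OF Pm(1)] emeasure_eq_measure2[OF Sm])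
  have "emeasure lborel (complex_of_vec -` B) \<le> emeasure lborel S"
    using order_trans[OF 3 4] vB S by simp
  then show ?thesis using 1 2 unfolding E_def by simp
qed

lemma nn_integral_polar_le:
  assumes f [measurable]: "f \<in> borel_measurable (borel :: complex measure)"
  shows "(\<integral>\<^sup>+z. f z * indicator {z. exp (- Y) < norm z \<and> norm z < 1} z \<partial>lborel) \<le>
    (\<integral>\<^sup>+x. \<integral>\<^sup>+y. f (exp (\<i> * Complex x y)) * indicator {0<..<Y} y * indicator {0..2*pi} x \<partial>lborel \<partial>lborel)"
proof -
  let ?A = "{z. exp (- Y) < norm z \<and> norm z < 1} :: complex set"
  define R where "R = {w::complex. Re w \<in> {0..2*pi} \<and> Im w \<in> {0<..<Y}}"
  have [measurable]: "R \<in> sets borel" unfolding R_def by measurable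
  have A [measurable]: "?A \<in> sets borel" by measurable
  have e [measurable]: "(\<lambda>w::complex. exp (\<i> * w)) \<in> borel_measurable borel"
    by (intro borel_measurable_continuous_onI continuous_intros)
  let ?M = "density lborel (indicator ?A) :: complex measure"
  let ?N = "distr (density lborel (indicator R)) borel (\<lambda>w. exp (\<i> * w)) :: complex measure"
  have "?M \<le> ?N"
  proof -
    have "emeasure ?M B \<le> emeasure ?N B" if B: "B \<in> sets borel" for B
    proof -
      have [measurable]: "B \<in> sets borel" by fact
      have "emeasure ?M B = emeasure lborel (?A \<inter> B)"
        by (subst emeasure_density) (auto simp flip: indicator_inter_arith simp: nn_integral_indicator)
      also have "\<dots> \<le> emeasure lborel {w. Re w \<in> {0..2*pi} \<and> Im w \<in> {0<..<Y} \<and> exp (\<i> * w) \<in> ?A \<inter> B}"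
        by (rule emeasure_polar_image_le) auto
      also have "\<dots> \<le> emeasure lborel (R \<inter> (\<lambda>w. exp (\<i> * w)) -` B)"
        by (intro emeasure_mono) (auto simp: R_def)
      also have "\<dots> = emeasure ?N B"
        using measurable_sets_borel[OF e B]
        by (subst emeasure_distr) (auto simp: emeasure_density simp flip: indicator_inter_arith simp: nn_integral_indicator)
      finally show ?thesis .
    qed
    moreover have "emeasure ?M B = 0" "emeasure ?N B = 0" if "B \<notin> sets borel" for B
      using that by (auto simp: emeasure_notin_sets)
    ultimately have "emeasure ?M B \<le> emeasure ?N B" for B by (cases "B \<in> sets borel") auto
    then show ?thesis by (simp add: le_measure_iff le_fun_def)
  qed
  then have "nn_integral ?M f \<le> nn_integral ?N f"
    by (intro nn_integral_mono_measure) auto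
  also have "nn_integral ?N f = (\<integral>\<^sup>+w. f (exp (\<i> * w)) * indicator R w \<partial>lborel)"
    by (simp add: nn_integral_distr nn_integral_density mult.commute)
  also have "\<dots> = (\<integral>\<^sup>+x. \<integral>\<^sup>+y. f (exp (\<i> * Complex x y)) * indicator R (Complex x y) \<partial>lborel \<partial>lborel)"
    by (subst nn_integral_complex_iterated) auto
  also have "\<dots> = (\<integral>\<^sup>+x. \<integral>\<^sup>+y. f (exp (\<i> * Complex x y)) * indicator {0<..<Y} y * indicator {0..2*pi} x \<partial>lborel \<partial>lborel)"
    by (intro nn_integral_cong) (auto simp: R_def split: split_indicator)
  finally show ?thesis by (simp add: nn_integral_density mult.commute)
qed

section \<open>The Beurling--Ahlfors extension of a lift\<close>

lemma has_derivative_half_sum_diff: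
  assumes "(f has_derivative f') (at z)" "(h has_derivative h') (at z)"
  shows "((\<lambda>z. Complex ((f z + h z) / 2) (f z - h z)) has_derivative
    (\<lambda>u. Complex ((f' u + h' u) / 2) (f' u - h' u))) (at z)"
  unfolding Complex_eq
  by (auto intro!: derivative_eq_intros assms simp: fun_eq_iff complex_eq_iff)

lemma periodic_continuous_bounded:
  fixes p :: "real \<Rightarrow> real"
  assumes "continuous_on UNIV p" and p: "\<And>x. p (x + 2*pi) = p x"
  obtains M where "0 \<le> M" "\<And>x. \<bar>p x\<bar> \<le> M"
proof -
  have pn: "p (x + 2*pi * of_int n) = p x" for x n
  proof (induction n arbitrary: x rule: int_induct[where k=0])
    case (step1 i)
    from step1(2)[of "x + 2*pi"] p[of x] show ?case by (simp add: algebra_simps)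
  next
    case (step2 i)
    from step2(2)[of "x - 2*pi"] p[of "x - 2*pi"] show ?case by (simp add: algebra_simps)
  qed simp
  have "compact (p ` {0..2*pi})"
    by (intro compact_continuous_image continuous_on_subset[OF assms(1)]) auto
  then obtain M where M: "\<And>x. x \<in> {0..2*pi} \<Longrightarrow> \<bar>p x\<bar> \<le> M"
    by (metis bounded_iff compact_imp_bounded imageI real_norm_def)
  have "\<bar>p x\<bar> \<le> M" for x
  proof -
    let ?n = "\<lfloor>x / (2*pi)\<rfloor>"
    have "of_int ?n \<le> x / (2*pi)" "x / (2*pi) < of_int ?n + 1" by linarith+
    then have "of_int ?n * (2*pi) \<le> x" "x < (of_int ?n + 1) * (2*pi)"
      using pos_le_divide_eq[of "2*pi" "of_int ?n" x] pos_divide_less_eq[of "2*pi" x "of_int ?n + 1"] pi_gt_zero by linarith+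
    then have "x + 2*pi * of_int (- ?n) \<in> {0..2*pi}" by (simp add: algebra_simps)
    from M[OF this] show ?thesis by (simp only: pn)
  qed
  moreover from this[of 0] have "0 \<le> M" by linarith
  ultimately show ?thesis using that by blast
qed

lemma norm_le_divide:
  assumes "0 < y" "Re z = s / y" "Im z = t / y" "\<bar>s\<bar> \<le> K / 2" "\<bar>t\<bar> \<le> K / 2"
  shows "norm z \<le> K / y"
proof -
  have "norm z \<le> \<bar>Re z\<bar> + \<bar>Im z\<bar>" by (rule cmod_le)
  also have "\<dots> = (\<bar>s\<bar> + \<bar>t\<bar>) / y" using assms by (simp add: abs_divide add_divide_distrib)
  also have "\<dots> \<le> K / y" using assms by (intro divide_right_mono) auto
  finally show ?thesis .
qed

locale circle_lift =
  fixes g :: "real \<Rightarrow> real"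
  assumes cont: "continuous_on UNIV g"
    and mono: "strict_mono g"
    and per: "g (x + 2*pi) = g x + 2*pi"
begin

lemma cont_comp [continuous_intros]: "continuous_on S f \<Longrightarrow> continuous_on S (\<lambda>x. g (f x))"
  by (rule continuous_on_compose2[OF cont]) auto

lemma g_less_iff [simp]: "g x < g y \<longleftrightarrow> x < y" and g_le_iff [simp]: "g x \<le> g y \<longleftrightarrow> x \<le> y"
  using mono by (auto simp: strict_mono_less strict_mono_less_eq)

text \<open>
  For \<open>y \<noteq> 0\<close> this is the mean value of \<open>g\<close> between \<open>x\<close> and \<open>x + y\<close>. Normalizing the interval to
  \<open>[0,1]\<close> includes the limit case \<open>y = 0\<close>, and lets \<open>av x (- y)\<close> serve as the mean value to the left.
\<close>

definition av :: "real \<Rightarrow> real \<Rightarrow> real" where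
  "av x y = integral {0..1} (\<lambda>t. g (x + t * y))"

lemma g_integrable: "(\<lambda>t. g (x + t * y)) integrable_on {a..b}"
  by (intro integrable_continuous_real continuous_intros)

lemma av_0 [simp]: "av x 0 = g x"
  by (simp add: av_def)

lemma continuous_on_av [continuous_intros]:
  assumes "continuous_on S f" "continuous_on S h"
  shows "continuous_on S (\<lambda>z. av (f z) (h z))"
proof -
  have "continuous_on UNIV (\<lambda>p. integral (cbox 0 1) (\<lambda>t. g (fst p + t * snd p)))"
    by (rule integral_continuous_on_param) (auto simp: case_prod_beta intro!: continuous_intros)
  then have "continuous_on UNIV (\<lambda>p. av (fst p) (snd p))"
    by (simp add: av_def)
  from continuous_on_compose2[OF this continuous_on_Pair[OF assms]] show ?thesis by simp
qed

lemma av_add_2pi: "av (x + 2*pi) y = av x y + 2*pi"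
proof -
  have "g (x + 2*pi + t*y) = g (x + t*y) + 2*pi" for t
    using per[of "x + t*y"] by (simp add: algebra_simps)
  moreover have "integral {0..1} (\<lambda>t. g (x + t*y) + 2*pi) = integral {0..1} (\<lambda>t. g (x + t*y)) + integral {0..1} (\<lambda>_::real. 2*pi)"
    by (rule Henstock_Kurzweil_Integration.integral_add[OF g_integrable integrable_const_ivl])
  ultimately show ?thesis
    by (simp add: av_def)
qed

lemma av_less_x: "x < x' \<Longrightarrow> av x y < av x' y"
  unfolding av_def by (intro integral_less_real) (auto intro!: continuous_intros)

lemma av_less_y: "y < y' \<Longrightarrow> av x y < av x y'"
  unfolding av_def by (intro integral_less_real) (auto intro!: continuous_intros)

lemma av_bounds:
  assumes "0 < y" shows "g x < av x y" "av x y < g (x + y)" "g (x - y) < av x (-y)" "av x (-y) < g x"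
proof -
  show "g x < av x y" "av x (-y) < g x" using av_less_y[of 0 y x] av_less_y[of "-y" 0 x] assms by auto
  have "av x y < integral {0..1} (\<lambda>t::real. g (x + y))" "integral {0..1} (\<lambda>t::real. g (x - y)) < av x (-y)"
    unfolding av_def
    subgoal by (rule integral_less_real) (use assms mult_strict_right_mono[OF _ assms, of _ 1] in \<open>auto intro!: continuous_intros\<close>)
    subgoal by (rule integral_less_real) (use assms mult_strict_right_mono[OF _ assms, of _ 1] in \<open>auto intro!: continuous_intros\<close>)
    done
  then show "av x y < g (x + y)" "g (x - y) < av x (-y)" by simp_all
qed

lemma primitive: "\<exists>G. \<forall>x. (G has_real_derivative g x) (at x)"
proof -
  have "\<exists>G. \<forall>x. -\<infinity> < ereal x \<longrightarrow> ereal x < \<infinity> \<longrightarrow> (G has_vector_derivative g x) (at x)"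
    by (rule einterval_antiderivative) (use cont continuous_on_eq_continuous_at in \<open>auto\<close>)
  then show ?thesis by (simp add: has_real_derivative_iff_has_vector_derivative)
qed

lemma av_eq_primitive:
  assumes G: "\<And>x. (G has_real_derivative g x) (at x)" and "y \<noteq> 0"
  shows "av x y = (G (x + y) - G x) / y"
proof -
  have "((\<lambda>t. g (x + t * y)) has_integral (G (x + 1 * y) / y - G (x + 0 * y) / y)) {0..1}"
    using assms
    by (intro fundamental_theorem_of_calculus)
       (auto intro!: derivative_eq_intros DERIV_chain2[OF G] simp flip: has_real_derivative_iff_has_vector_derivative)
  then show ?thesis unfolding av_def by (simp add: integral_unique diff_divide_distrib)
qed

text \<open>
  The mean value is a difference quotient \<open>(G(x+y) - G(x))/y\<close> of a primitive \<open>G\<close> of \<open>g\<close>; this is where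
  the merely continuous \<open>g\<close> gains one derivative.
\<close>

lemma has_derivative_av:
  assumes y: "h z \<noteq> 0" and f: "(f has_derivative f') (at z)" and h: "(h has_derivative h') (at z)"
  shows "((\<lambda>z. av (f z) (h z)) has_derivative
    (\<lambda>u. f' u * ((g (f z + h z) - g (f z)) / h z) + h' u * ((g (f z + h z) - av (f z) (h z)) / h z)))
    (at (z::complex))"
proof -
  obtain G where G: "\<And>x. (G has_real_derivative g x) (at x)" using primitive by blast
  have Gd: "((\<lambda>z. G (k z)) has_derivative (\<lambda>u. k' u * g (k z))) (at z)" if "(k has_derivative k') (at z)" for k k'
    using has_derivative_compose[OF that G[unfolded has_field_derivative_def]] by (simp add: mult.commute)
  have "isCont h z" using h has_derivative_continuous by blast
  then have "\<forall>\<^sub>F z in at z. h z \<noteq> 0" using y by (simp add: isCont_def tendsto_imp_eventually_ne)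
  then have ev: "\<forall>\<^sub>F z in at z. (G (f z + h z) - G (f z)) / h z = av (f z) (h z)"
    by eventually_elim (simp add: av_eq_primitive[OF G])
  have "((\<lambda>z. (G (f z + h z) - G (f z)) / h z) has_derivative
    (\<lambda>u. f' u * ((g (f z + h z) - g (f z)) / h z) + h' u * ((g (f z + h z) - av (f z) (h z)) / h z))) (at z)"
    using y by (auto intro!: derivative_eq_intros Gd f h simp: av_eq_primitive[OF G] fun_eq_iff field_simps power2_eq_square)
  then show ?thesis
    by (rule has_derivative_transform_eventually[OF _ ev]) (use y in \<open>auto simp: av_eq_primitive[OF G]\<close>)
qed

text \<open>
  The Beurling--Ahlfors extension. The factor \<open>1/2\<close> in the real part alone makes it the identity
  for \<open>g x = x\<close>, so that in general it is close to a translation far from the real axis.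
\<close>

definition BA :: "complex \<Rightarrow> complex" where
  "BA w = Complex ((av (Re w) (Im w) + av (Re w) (- Im w)) / 2) (av (Re w) (Im w) - av (Re w) (- Im w))"

text \<open>
  The partial derivatives of the mean values \<open>\<alpha> = av x y\<close> and \<open>\<beta> = av x (- y)\<close>:
  \<open>\<alpha>\<close> has the partial derivatives \<open>slope_up\<close> and \<open>gap_up\<close>, and \<open>\<beta>\<close> has \<open>slope_dn\<close> and \<open>- gap_dn\<close>.
  All four quantities are positive for \<open>y > 0\<close>.
\<close>

abbreviation (input) "slope_up w \<equiv> (g (Re w + Im w) - g (Re w)) / Im w"
abbreviation (input) "slope_dn w \<equiv> (g (Re w) - g (Re w - Im w)) / Im w"
abbreviation (input) "gap_up w \<equiv> (g (Re w + Im w) - av (Re w) (Im w)) / Im w"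
abbreviation (input) "gap_dn w \<equiv> (av (Re w) (- Im w) - g (Re w - Im w)) / Im w"

definition BAx :: "complex \<Rightarrow> complex" where
  "BAx w = Complex ((slope_up w + slope_dn w) / 2) (slope_up w - slope_dn w)"
definition BAy :: "complex \<Rightarrow> complex" where
  "BAy w = Complex ((gap_up w - gap_dn w) / 2) (gap_up w + gap_dn w)"

lemma continuous_on_BA: "continuous_on S BA"
  unfolding BA_def by (intro continuous_intros) auto

lemma continuous_on_BAx: "continuous_on {w. 0 < Im w} BAx"
  unfolding BAx_def by (intro continuous_intros) auto

lemma continuous_on_BAy: "continuous_on {w. 0 < Im w} BAy"
  unfolding BAy_def by (intro continuous_intros) auto

lemma has_derivative_BA:
  assumes "0 < Im w"
  shows "(BA has_derivative diff_map (BAx w) (BAy w)) (at w)"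
proof -
  have y: "Im w \<noteq> 0" "- Im w \<noteq> 0" using assms by auto
  note av1 = has_derivative_av[OF y(1) bounded_linear_imp_has_derivative[OF bounded_linear_Re] bounded_linear_imp_has_derivative[OF bounded_linear_Im]]
  note av2 = has_derivative_av[OF y(2) bounded_linear_imp_has_derivative[OF bounded_linear_Re]
    has_derivative_minus[OF bounded_linear_imp_has_derivative[OF bounded_linear_Im]]]
  show ?thesis
    unfolding BA_def[abs_def]
    by (rule has_derivative_eq_rhs[OF has_derivative_half_sum_diff[OF av1 av2]])
       (simp add: fun_eq_iff diff_map_def BAx_def BAy_def complex_eq_iff diff_divide_distrib add_divide_distrib algebra_simps)
qed

lemma jac_BA: "jac (BAx w) (BAy w) = slope_up w * gap_dn w + slope_dn w * gap_up w"
proof -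
  have "jac (Complex ((A + B)/2) (A - B)) (Complex ((a - b)/2) (a + b)) = A * b + B * a" for A B a b
    by (simp add: jac_def field_simps)
  then show ?thesis unfolding BAx_def BAy_def .
qed

lemma jac_BA_pos: "0 < Im w \<Longrightarrow> 0 < jac (BAx w) (BAy w)"
  unfolding jac_BA using av_bounds[of "Im w" "Re w"]
  by (intro add_pos_pos mult_pos_pos divide_pos_pos) auto

lemma Im_BA_pos: "0 < Im w \<Longrightarrow> 0 < Im (BA w)"
  using av_bounds[of "Im w" "Re w"] by (simp add: BA_def)

lemma BA_real: "Im w = 0 \<Longrightarrow> BA w = of_real (g (Re w))"
  by (simp add: BA_def complex_eq_iff)

text \<open>
  Suppose that two points have the same mean values and the second lies further to the right. To keep
  \<open>\<alpha>\<close> it must lie lower; but moving right and moving down both increase \<open>\<beta>\<close>.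
\<close>

lemma BA_inj:
  assumes eq: "BA w = BA w'" and pos: "0 \<le> Im w" "0 \<le> Im w'"
  shows "w = w'"
proof -
  have a: "av (Re w) (Im w) = av (Re w') (Im w')" and b: "av (Re w) (- Im w) = av (Re w') (- Im w')"
    using eq by (auto simp: BA_def)
  have False if lt: "x < x'" and a: "av x y = av x' y'" and b: "av x (-y) = av x' (-y')" for x x' y y'
  proof -
    have "av x' y' < av x' y" using av_less_x[OF lt, of y] a by simp
    then have "y' < y" using av_less_y[of y y' x'] by (metis less_asym not_less_iff_gr_or_eq)
    then have "av x (-y) < av x' (-y')"
      using av_less_x[OF lt, of "-y"] av_less_y[of "-y" "-y'" x'] by simp
    with b show False by simp
  qed
  from this[OF _ a b] this[OF _ a[symmetric] b[symmetric]] have x: "Re w = Re w'" by force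
  have "Im w = Im w'"
    using av_less_y[of "Im w" "Im w'" "Re w"] av_less_y[of "Im w'" "Im w" "Re w"] a x
    by (metis less_irrefl linorder_neqE_linordered_idom)
  with x show ?thesis by (simp add: complex_eq_iff)
qed

lemma av_add_2pi_int: "av (x + 2*pi * of_int n) y = av x y + 2*pi * of_int n"
proof (induction n arbitrary: x rule: int_induct[where k=0])
  case (step1 i)
  from step1(2)[of "x + 2*pi"] av_add_2pi[of x y] show ?case by (simp add: algebra_simps)
next
  case (step2 i)
  from step2(2)[of "x - 2*pi"] av_add_2pi[of "x - 2*pi" y] show ?case by (simp add: algebra_simps)
qed simp

lemma g_add_2pi_int: "g (x + 2*pi * of_int n) = g x + 2*pi * of_int n"
  using av_add_2pi_int[of x n 0] by simp

lemma BA_add_2pi_int: "BA (w + of_real (2*pi * of_int n)) = BA w + of_real (2*pi * of_int n)"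
proof -
  have "Re (w + of_real (2*pi * of_int n)) = Re w + 2*pi * of_int n" "Im (w + of_real (2*pi * of_int n)) = Im w"
    by simp_all
  then show ?thesis by (simp only: BA_def av_add_2pi_int) (simp add: complex_eq_iff)
qed

text \<open>
  A primitive of \<open>g x - x\<close> is the sum of a linear function, whose slope is the mean \<open>m\<close>, and a periodic
  function \<open>Q\<close>. The linear part contributes \<open>m\<close> to every mean value, and the bounded periodic part
  contributes at most \<open>2 sup \<bar>Q\<bar> / \<bar>y\<bar>\<close>.
\<close>

lemma av_asymptotics:
  obtains m C where "0 \<le> C" "\<And>x y. y \<noteq> 0 \<Longrightarrow> \<bar>av x y - (x + y/2 + m)\<bar> \<le> C / \<bar>y\<bar>"
proof -
  obtain G where G: "\<And>x. (G has_real_derivative g x) (at x)" using primitive by blast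
  define P where "P x = G x - x\<^sup>2/2" for x
  have P: "(P has_real_derivative g x - x) (at x)" for x
    unfolding P_def by (auto intro!: derivative_eq_intros G)
  define m where "m = (P (2*pi) - P 0) / (2*pi)"
  define Q where "Q x = P x - m * x" for x
  have Q': "(Q has_real_derivative g x - x - m) (at x)" for x
    unfolding Q_def by (auto intro!: derivative_eq_intros P)
  have "((\<lambda>x. Q (x + 2*pi) - Q x) has_real_derivative 0) (at x)" for x
    using per[of x] by (auto intro!: derivative_eq_intros DERIV_chain2[OF Q'] Q')
  then have "Q (x + 2*pi) - Q x = Q (0 + 2*pi) - Q 0" for x
    by (intro DERIV_isconst_all) auto 
  moreover have "Q (0 + 2*pi) - Q 0 = 0" by (simp add: Q_def m_def)
  ultimately have Qp: "Q (x + 2*pi) = Q x" for x by simp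
  have Qc: "continuous_on UNIV Q"
    using Q' DERIV_isCont by (blast intro: continuous_at_imp_continuous_on)
  obtain M where M: "0 \<le> M" "\<And>x. \<bar>Q x\<bar> \<le> M"
    by (rule periodic_continuous_bounded[OF Qc Qp]) blast
  show ?thesis
  proof (rule that[of "2*M" m])
    fix x y :: real assume y: "y \<noteq> 0"
    have "av x y - (x + y/2 + m) = (Q (x + y) - Q x) / y"
      using y by (simp add: av_eq_primitive[OF G] Q_def P_def field_simps power2_eq_square)
    then have "\<bar>av x y - (x + y/2 + m)\<bar> = \<bar>Q (x + y) - Q x\<bar> / \<bar>y\<bar>" by simp
    also have "\<dots> \<le> (2*M) / \<bar>y\<bar>"
      using M(2)[of "x+y"] M(2)[of x] by (intro divide_right_mono) auto
    finally show "\<bar>av x y - (x + y/2 + m)\<bar> \<le> (2*M) / \<bar>y\<bar>" .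
  qed (use M in auto)
qed

lemma BA_asymptotics:
  obtains m C where "0 \<le> C"
    "\<And>w. 1 \<le> Im w \<Longrightarrow> norm (BA w - w - of_real m) \<le> C / Im w"
    "\<And>w. 1 \<le> Im w \<Longrightarrow> norm (BAx w - 1) \<le> C / Im w"
    "\<And>w. 1 \<le> Im w \<Longrightarrow> norm (BAy w - \<i>) \<le> C / Im w"
proof -
  obtain m C where C: "0 \<le> C" "\<And>x y. y \<noteq> 0 \<Longrightarrow> \<bar>av x y - (x + y/2 + m)\<bar> \<le> C / \<bar>y\<bar>"
    by (rule av_asymptotics, rule that)
  have "continuous_on UNIV (\<lambda>x. g x - x)" by (intro continuous_intros)
  moreover have "g (x + 2*pi) - (x + 2*pi) = g x - x" for x using per[of x] by simp
  ultimately obtain M where M: "0 \<le> M" "\<And>x. \<bar>g x - x\<bar> \<le> M"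
    by (rule periodic_continuous_bounded) blast
  define N where "N = \<bar>m\<bar>"
  have m: "m \<le> N" "- m \<le> N" "0 \<le> N" by (simp_all add: N_def)
  define K where "K = 8 * (C + M + N)"
  show ?thesis
  proof (rule that[of K m])
    show "0 \<le> K" using C(1) M(1) m by (simp add: K_def)
    fix w :: complex assume w: "1 \<le> Im w"
    define x y where "x = Re w" and "y = Im w"
    have y: "y \<ge> 1" using w by (simp add: y_def)
    define e1 e2 where "e1 = av x y - (x + y/2 + m)" and "e2 = av x (-y) - (x - y/2 + m)"
    have e: "\<bar>e1\<bar> \<le> C / y" "\<bar>e2\<bar> \<le> C / y"
      using C(2)[of y x] C(2)[of "-y" x] y by (auto simp: e1_def e2_def)
    have av: "av x y = x + y/2 + m + e1" "av x (-y) = x - y/2 + m + e2" by (auto simp: e1_def e2_def)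
    define p where "p x = g x - x" for x
    have p: "\<bar>p x\<bar> \<le> M" for x using M by (simp add: p_def)
    have g: "g x = x + p x" for x by (simp add: p_def)
    have y0: "0 < Im w" using w by simp
    have ey: "\<bar>e1 * y\<bar> \<le> C" "\<bar>e2 * y\<bar> \<le> C"
      using e y by (simp_all add: pos_le_divide_eq abs_mult)
    have e': "\<bar>e1\<bar> \<le> C" "\<bar>e2\<bar> \<le> C"
    proof -
      have "C / y \<le> C" using y C(1) by (simp add: divide_le_eq mult_le_cancel_left1)
      then show "\<bar>e1\<bar> \<le> C" "\<bar>e2\<bar> \<le> C" using e by linarith+
    qed
    note xy = x_def[symmetric] y_def[symmetric]
    show "norm (BA w - w - of_real m) \<le> K / Im w"
    proof (rule norm_le_divide[OF y0])
      show "Re (BA w - w - of_real m) = ((e1 * y + e2 * y) / 2) / Im w"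
        using y by (simp add: BA_def av xy field_simps)
      show "Im (BA w - w - of_real m) = (e1 * y - e2 * y) / Im w"
        using y by (simp add: BA_def av xy field_simps)
      show "\<bar>(e1 * y + e2 * y) / 2\<bar> \<le> K / 2"
        unfolding K_def using ey(1)[THEN abs_le_D1] ey(1)[THEN abs_le_D2] ey(2)[THEN abs_le_D1] ey(2)[THEN abs_le_D2] C(1) M(1) m by (intro abs_leI) argo+
      show "\<bar>e1 * y - e2 * y\<bar> \<le> K / 2"
        unfolding K_def using ey(1)[THEN abs_le_D1] ey(1)[THEN abs_le_D2] ey(2)[THEN abs_le_D1] ey(2)[THEN abs_le_D2] C(1) M(1) m by (intro abs_leI) argo+
    qed
    show "norm (BAx w - 1) \<le> K / Im w"
    proof (rule norm_le_divide[OF y0])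
      show "Re (BAx w - 1) = ((p (x+y) - p (x-y)) / 2) / Im w"
        using y by (simp add: BAx_def g xy field_simps)
      show "Im (BAx w - 1) = (p (x+y) + p (x-y) - 2 * p x) / Im w"
        using y by (simp add: BAx_def g xy field_simps)
      show "\<bar>(p (x+y) - p (x-y)) / 2\<bar> \<le> K / 2"
        unfolding K_def using p[of "x+y", THEN abs_le_D1] p[of "x+y", THEN abs_le_D2] p[of x, THEN abs_le_D1] p[of x, THEN abs_le_D2] p[of "x-y", THEN abs_le_D1] p[of "x-y", THEN abs_le_D2] C(1) M(1) m by (intro abs_leI) argo+
      show "\<bar>p (x+y) + p (x-y) - 2 * p x\<bar> \<le> K / 2"
        unfolding K_def using p[of "x+y", THEN abs_le_D1] p[of "x+y", THEN abs_le_D2] p[of x, THEN abs_le_D1] p[of x, THEN abs_le_D2] p[of "x-y", THEN abs_le_D1] p[of "x-y", THEN abs_le_D2] C(1) M(1) m by (intro abs_leI) argo+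
    qed
    show "norm (BAy w - \<i>) \<le> K / Im w"
    proof (rule norm_le_divide[OF y0])
      show "Re (BAy w - \<i>) = ((p (x+y) + p (x-y) - 2 * m - e1 - e2) / 2) / Im w"
        using y by (simp add: BAy_def g av xy field_simps)
      show "Im (BAy w - \<i>) = (p (x+y) - p (x-y) + e2 - e1) / Im w"
        using y by (simp add: BAy_def g av xy field_simps)
      show "\<bar>(p (x+y) + p (x-y) - 2 * m - e1 - e2) / 2\<bar> \<le> K / 2"
        unfolding K_def using p[of "x+y", THEN abs_le_D1] p[of "x+y", THEN abs_le_D2] p[of "x-y", THEN abs_le_D1] p[of "x-y", THEN abs_le_D2] e'(1)[THEN abs_le_D1] e'(1)[THEN abs_le_D2] e'(2)[THEN abs_le_D1] e'(2)[THEN abs_le_D2] C(1) M(1) m by (intro abs_leI) argo+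
      show "\<bar>p (x+y) - p (x-y) + e2 - e1\<bar> \<le> K / 2"
        unfolding K_def using p[of "x+y", THEN abs_le_D1] p[of "x+y", THEN abs_le_D2] p[of "x-y", THEN abs_le_D1] p[of "x-y", THEN abs_le_D2] e'(1)[THEN abs_le_D1] e'(1)[THEN abs_le_D2] e'(2)[THEN abs_le_D1] e'(2)[THEN abs_le_D2] C(1) M(1) m by (intro abs_leI) argo+
    qed
  qed
qed

end

section \<open>Dilatation and symmetric distortion\<close>

text \<open>
  A period translated by at most one period is covered by three consecutive periods.
\<close>

lemma nn_integral_period_shift_le:
  fixes f :: "real \<Rightarrow> ennreal"
  assumes [measurable]: "f \<in> borel_measurable borel"
    and per: "\<And>x. f (x + 2*pi) = f x" and c: "\<bar>c\<bar> \<le> 2*pi"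
  shows "(\<integral>\<^sup>+x. f (x + c) * indicator {0..2*pi} x \<partial>lborel) \<le> 3 * (\<integral>\<^sup>+x. f x * indicator {0..2*pi} x \<partial>lborel)"
proof -
  let ?I = "\<integral>\<^sup>+x. f x * indicator {0..2*pi} x \<partial>lborel"
  have shift: "(\<integral>\<^sup>+x. h x \<partial>lborel) = (\<integral>\<^sup>+x. h (x + d) \<partial>lborel)" if "h \<in> borel_measurable borel" for h :: "real \<Rightarrow> ennreal" and d
    using nn_integral_real_affine[OF that, of 1 d] by (simp add: add.commute)
  have "(\<integral>\<^sup>+x. f (x + c) * indicator {0..2*pi} x \<partial>lborel) = (\<integral>\<^sup>+x. f x * indicator {0..2*pi} (x - c) \<partial>lborel)"
    by (subst shift[of _ c]) auto
  also have "\<dots> \<le> (\<integral>\<^sup>+x. f x * indicator {0..2*pi} (x + 2*pi) + f x * indicator {0..2*pi} x + f x * indicator {0..2*pi} (x - 2*pi) \<partial>lborel)"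
    using c by (intro nn_integral_mono) (auto split: split_indicator simp: add_increasing)
  also have "\<dots> = (\<integral>\<^sup>+x. f x * indicator {0..2*pi} (x + 2*pi) \<partial>lborel) + ?I + (\<integral>\<^sup>+x. f x * indicator {0..2*pi} (x - 2*pi) \<partial>lborel)"
    by (simp add: nn_integral_add)
  also have "(\<integral>\<^sup>+x. f x * indicator {0..2*pi} (x + 2*pi) \<partial>lborel) = ?I"
    using per by (subst shift[of "\<lambda>x. f x * indicator {0..2*pi} x" "2*pi"]) auto
  also have "(\<integral>\<^sup>+x. f x * indicator {0..2*pi} (x - 2*pi) \<partial>lborel) = ?I"
    using per by (subst shift[of "\<lambda>x. f x * indicator {0..2*pi} (x - 2*pi)" "2*pi"]) auto
  also have "?I + ?I + ?I = 3 * ?I"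
  proof -
    have "(3::ennreal) = 1 + 1 + 1" by simp
    then show ?thesis by (simp only: distrib_right mult_1)
  qed
  finally show ?thesis .
qed

text \<open>
  For fixed \<open>y\<close> the shear translates by at most one period, which at most triples the integral over
  a period; the substitution \<open>t = k y\<close> accounts for the factor \<open>1/k\<close>.
\<close>

lemma nn_integral_sheared_le:
  fixes f :: "real \<Rightarrow> real \<Rightarrow> ennreal"
  assumes f[measurable]: "case_prod f \<in> borel_measurable (borel \<Otimes>\<^sub>M borel)"
    and per: "\<And>x t. f (x + 2*pi) t = f x t"
    and c: "\<bar>c\<bar> \<le> 1" and T: "0 < T" "T \<le> 2*pi" and k: "0 < k" "k \<le> 1"
  shows "(\<integral>\<^sup>+x. \<integral>\<^sup>+y. f (x + c * y) (k * y) * indicator {0<..<T} y * indicator {0..2*pi} x \<partial>lborel \<partial>lborel)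
    \<le> ennreal (3 / k) * (\<integral>\<^sup>+x. \<integral>\<^sup>+t. f x t * indicator {0<..<T} t * indicator {0..2*pi} x \<partial>lborel \<partial>lborel)"
proof -
  have pair: "borel_measurable (lborel \<Otimes>\<^sub>M lborel) = borel_measurable (borel \<Otimes>\<^sub>M borel)"
    by (intro measurable_cong_sets sets_pair_measure_cong) auto
  have [measurable]: "case_prod f \<in> borel_measurable (lborel \<Otimes>\<^sub>M lborel)"
    by (simp add: pair f)
  define R where "R t = (\<integral>\<^sup>+x. f x t * indicator {0..2*pi} x \<partial>lborel)" for t
  have R[measurable]: "R \<in> borel_measurable borel" unfolding R_def by measurable
  have "(\<integral>\<^sup>+x. \<integral>\<^sup>+y. f (x + c * y) (k * y) * indicator {0<..<T} y * indicator {0..2*pi} x \<partial>lborel \<partial>lborel)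
    = (\<integral>\<^sup>+y. \<integral>\<^sup>+x. f (x + c * y) (k * y) * indicator {0<..<T} y * indicator {0..2*pi} x \<partial>lborel \<partial>lborel)"
    by (rule lborel_pair.Fubini'[symmetric]) measurable
  also have "\<dots> \<le> (\<integral>\<^sup>+y. 3 * (R (0 + k * y) * indicator {0<..<T} (0 + k * y)) \<partial>lborel)"
  proof (rule nn_integral_mono)
    fix y :: real
    show "(\<integral>\<^sup>+x. f (x + c * y) (k * y) * indicator {0<..<T} y * indicator {0..2*pi} x \<partial>lborel)
      \<le> 3 * (R (0 + k * y) * indicator {0<..<T} (0 + k * y))"
    proof (cases "y \<in> {0<..<T}")
      case True
      have "k * y \<le> y" using True k by simp
      then have "k * y < T" using True by (meson greaterThanLessThan_iff le_less_trans)
      then have ky: "k * y \<in> {0<..<T}" using True k by simp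
      have "\<bar>c\<bar> * \<bar>y\<bar> \<le> 1 * \<bar>y\<bar>" using c by (intro mult_right_mono) auto
      then have "\<bar>c * y\<bar> \<le> \<bar>y\<bar>" by (simp only: abs_mult mult_1)
      moreover have "\<bar>y\<bar> \<le> 2*pi" using True T by simp
      ultimately have cy: "\<bar>c * y\<bar> \<le> 2*pi" by (rule order_trans)
      have m: "(\<lambda>x. f x (k * y)) \<in> borel_measurable borel" by measurable
      have p: "f (x + 2*pi) (k * y) = f x (k * y)" for x by (rule per)
      from nn_integral_period_shift_le[of "\<lambda>x. f x (k * y)" "c * y", OF m p cy] show ?thesis
        using True ky by (simp add: R_def)
    qed auto
  qed
  also have "\<dots> = 3 * (\<integral>\<^sup>+y. R (0 + k * y) * indicator {0<..<T} (0 + k * y) \<partial>lborel)"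
    by (subst nn_integral_cmult) auto
  also have "(\<integral>\<^sup>+y. R (0 + k * y) * indicator {0<..<T} (0 + k * y) \<partial>lborel) = ennreal (1/k) * (\<integral>\<^sup>+t. R t * indicator {0<..<T} t \<partial>lborel)"
    using k by (subst (2) nn_integral_real_affine[of _ k 0]) (auto simp: mult.assoc[symmetric] simp flip: ennreal_mult)
  also have "(\<integral>\<^sup>+t. R t * indicator {0<..<T} t \<partial>lborel) = (\<integral>\<^sup>+t. \<integral>\<^sup>+x. f x t * indicator {0<..<T} t * indicator {0..2*pi} x \<partial>lborel \<partial>lborel)"
    unfolding R_def by (intro nn_integral_cong) (auto split: split_indicator)
  also have "\<dots> = (\<integral>\<^sup>+x. \<integral>\<^sup>+t. f x t * indicator {0<..<T} t * indicator {0..2*pi} x \<partial>lborel \<partial>lborel)"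
    by (rule lborel_pair.Fubini') measurable
  also have "3 * (ennreal (1/k) * (\<integral>\<^sup>+x. \<integral>\<^sup>+t. f x t * indicator {0<..<T} t * indicator {0..2*pi} x \<partial>lborel \<partial>lborel))
    = ennreal (3 / k) * (\<integral>\<^sup>+x. \<integral>\<^sup>+t. f x t * indicator {0<..<T} t * indicator {0..2*pi} x \<partial>lborel \<partial>lborel)"
  proof -
    have "ennreal (3 / k) = 3 * ennreal (1 / k)"
      using k ennreal_mult[of 3 "1/k"] by simp
    then show ?thesis by (simp add: mult.assoc)
  qed
  finally show ?thesis .
qed

lemma frob_dilatation_mean_diff_le:
  fixes A B a b y :: real
  assumes pos: "0 < y" "0 < A" "0 < B" "0 < a" "0 < b" and le: "a \<le> A" "b \<le> B"
  shows "frob_dilatation (Complex ((A/y + B/y)/2) (A/y - B/y)) (Complex ((a/y - b/y)/2) (a/y + b/y))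
    \<le> 7 * (max A B)\<^sup>2 / (A * b + B * a)"
proof -
  let ?M = "max A B"
  let ?N = "((A + B)/2)\<^sup>2 + (A - B)\<^sup>2 + ((a - b)/2)\<^sup>2 + (a + b)\<^sup>2"
  have "\<bar>(A + B)/2\<bar> \<le> ?M" "\<bar>A - B\<bar> \<le> ?M" "\<bar>(a - b)/2\<bar> \<le> ?M/2" "\<bar>a + b\<bar> \<le> 2 * ?M"
    using pos le by (auto simp: max_def abs_le_iff)
  then have "((A + B)/2)\<^sup>2 \<le> ?M\<^sup>2" "(A - B)\<^sup>2 \<le> ?M\<^sup>2" "((a - b)/2)\<^sup>2 \<le> (?M/2)\<^sup>2" "(a + b)\<^sup>2 \<le> (2*?M)\<^sup>2"
    using power_mono[OF _ abs_ge_zero, of _ _ 2] by (metis power2_abs)+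
  moreover have "(?M/2)\<^sup>2 \<le> ?M\<^sup>2" "(2*?M)\<^sup>2 = 4 * ?M\<^sup>2"
    by (simp_all add: power_divide power_mult_distrib)
  ultimately have N: "?N \<le> 7 * ?M\<^sup>2" by linarith
  have num: "(norm (Complex ((A/y + B/y)/2) (A/y - B/y)))\<^sup>2 + (norm (Complex ((a/y - b/y)/2) (a/y + b/y)))\<^sup>2 = ?N / y\<^sup>2"
  proof -
    have "(A/y + B/y)/2 = ((A + B)/2)/y" "A/y - B/y = (A - B)/y" "(a/y - b/y)/2 = ((a - b)/2)/y" "a/y + b/y = (a + b)/y"
      by (simp_all add: add_divide_distrib diff_divide_distrib)
    then show ?thesis by (simp only: cmod_power2 complex.sel power_divide[of _ y] add_divide_distrib[of _ _ "y\<^sup>2"]) 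
  qed
  have jac: "jac (Complex ((A/y + B/y)/2) (A/y - B/y)) (Complex ((a/y - b/y)/2) (a/y + b/y)) = (A * b + B * a) / y\<^sup>2"
    using pos by (simp add: jac_def field_simps power2_eq_square)
  have "frob_dilatation (Complex ((A/y + B/y)/2) (A/y - B/y)) (Complex ((a/y - b/y)/2) (a/y + b/y)) = ?N / (A * b + B * a)"
    unfolding frob_dilatation_def num jac using pos by simp
  also have "\<dots> \<le> 7 * ?M\<^sup>2 / (A * b + B * a)"
    using N pos by (intro divide_right_mono) auto
  finally show ?thesis .
qed

text \<open>
  The two ways in which the quotient \<open>7 A\<^sup>2 / (A b + B a)\<close> is bounded linearly: drop \<open>A b\<close> when \<open>a\<close> is
  comparable to \<open>A\<close>, or drop \<open>B a\<close> when \<open>b\<close> is not too small compared with \<open>A\<close>.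
\<close>

lemma ratio_bound_near:
  fixes A B a b R :: real
  assumes "0 < A" "0 < B" "0 < a" "0 < b" "A / 4 \<le> a" "A / B \<le> R"
  shows "7 * A\<^sup>2 / (A * b + B * a) \<le> 56 * R"
proof -
  have "A / 4 * B \<le> a * B" using assms by (intro mult_right_mono) auto
  then have "7 * A\<^sup>2 / (A * b + B * a) \<le> 7 * A\<^sup>2 / (A * B / 4)"
    using assms by (intro divide_left_mono) (auto simp: algebra_simps add_pos_pos intro: order_trans add_increasing)
  also have "\<dots> = 28 * (A / B)" using assms by (simp add: field_simps power2_eq_square)
  also have "\<dots> \<le> 56 * R" using assms divide_pos_pos[of A B] by linarith
  finally show ?thesis .
qed

lemma ratio_bound_far:
  fixes A B a b R :: real
  assumes "0 < A" "0 < B" "0 < a" "0 < b" "A \<le> 8 * R * b"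
  shows "7 * A\<^sup>2 / (A * b + B * a) \<le> 56 * R"
proof -
  have "7 * A\<^sup>2 / (A * b + B * a) \<le> 7 * A\<^sup>2 / (A * b)"
    using assms by (intro divide_left_mono mult_pos_pos add_pos_pos) auto
  also have "\<dots> = 7 * (A / b)" using assms by (simp add: power2_eq_square)
  also have "\<dots> \<le> 7 * (8 * R)" using assms by (intro mult_left_mono) (auto simp: field_simps)
  finally show ?thesis by simp
qed

context circle_lift begin

definition distortion :: "real \<Rightarrow> real \<Rightarrow> real" where
  "distortion x t = max ((g (x + t) - g x) / (g x - g (x - t))) ((g x - g (x - t)) / (g (x + t) - g x))"

text \<open>
  A monotone function is bounded by its right end value on each of the two pieces of \<open>[x, x + y]\<close>
  cut at \<open>x + c y\<close>, and from below by its left end values on the pieces of \<open>[x - y, x]\<close>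
  cut at \<open>x - c y\<close>.
\<close>

lemma av_split:
  assumes c: "0 \<le> c" "c \<le> 1" and y: "0 \<le> y"
  shows "av x y \<le> c * g (x + c * y) + (1 - c) * g (x + y)"
    and "c * g (x - c * y) + (1 - c) * g (x - y) \<le> av x (- y)"
proof -
  have split: "av x y = integral {0..c} (\<lambda>t. g (x + t * y)) + integral {c..1} (\<lambda>t. g (x + t * y))" for y
    unfolding av_def
    by (rule Henstock_Kurzweil_Integration.integral_combine[symmetric]) (use c g_integrable in auto)
  have const: "integral {0..c} (\<lambda>t::real. a) = c * a" "integral {c..1} (\<lambda>t::real. b) = (1 - c) * b" for a b :: real
    using c by auto
  have "integral {0..c} (\<lambda>t. g (x + t * y)) \<le> integral {0..c} (\<lambda>t::real. g (x + c * y))"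
       "integral {0..c} (\<lambda>t::real. g (x - c * y)) \<le> integral {0..c} (\<lambda>t. g (x + t * - y))"
       "integral {c..1} (\<lambda>t. g (x + t * y)) \<le> integral {c..1} (\<lambda>t::real. g (x + y))"
       "integral {c..1} (\<lambda>t::real. g (x - y)) \<le> integral {c..1} (\<lambda>t. g (x + t * - y))"
    by (rule integral_le; use y c in \<open>auto intro!: g_integrable integrable_continuous_real continuous_intros mult_right_mono mult_left_le_one_le\<close>)+
  then show "av x y \<le> c * g (x + c * y) + (1 - c) * g (x + y)"
    "c * g (x - c * y) + (1 - c) * g (x - y) \<le> av x (- y)"
    unfolding split const by linarith+
qed

text \<open>
  Let \<open>A\<close>, \<open>B\<close> be the increments of \<open>g\<close> over \<open>[x, x+y]\<close> and \<open>[x-y, x]\<close>, and \<open>a\<close>, \<open>b\<close> the differences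
  between the mean values over these intervals and the values of \<open>g\<close> at the outer end points. The
  dilatation is at most \<open>7 max(A,B)\<^sup>2 / (A b + B a)\<close>. Let \<open>A \<ge> B\<close>; the other case is its mirror image.
  If at least half of the increment \<open>A\<close> falls to the outer half of \<open>[x, x+y]\<close>, then \<open>a \<ge> A/4\<close>, and
  \<open>A/B \<le> \<rho>(x,y)\<close> bounds the quotient. Otherwise at least half of \<open>A\<close> falls to \<open>[x, x+y/2]\<close>, hence to the
  right half of the interval \<open>[x-y, x+y/2]\<close> centred at \<open>x - y/4\<close>. The increment over its left half is
  at most \<open>4 b\<close>, since \<open>g\<close> exceeds its value at \<open>x - y/4\<close> on a quarter of \<open>[x-y, x]\<close>. So
  \<open>A \<le> 8 b \<rho>(x - y/4, 3y/4)\<close>.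
\<close>

lemma frob_dilatation_BA_le:
  assumes y: "0 < Im w"
  defines "x \<equiv> Re w" and "y \<equiv> Im w"
  shows "frob_dilatation (BAx w) (BAy w)
    \<le> 56 * max (distortion x y) (max (distortion (x - y/4) (3*y/4)) (distortion (x + y/4) (3*y/4)))"
    (is "_ \<le> 56 * ?R")
proof -
  have y: "0 < y" using y by (simp add: y_def)
  define A B a b where "A = g (x + y) - g x" and "B = g x - g (x - y)"
    and "a = g (x + y) - av x y" and "b = av x (- y) - g (x - y)"
  have pos: "0 < A" "0 < B" "0 < a" "0 < b" "a \<le> A" "b \<le> B"
    using av_bounds[OF y, of x] y by (auto simp: A_def B_def a_def b_def)
  have "frob_dilatation (BAx w) (BAy w) \<le> 7 * (max A B)\<^sup>2 / (A * b + B * a)"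
    using frob_dilatation_mean_diff_le[OF y pos]
    by (simp add: BAx_def BAy_def A_def B_def a_def b_def x_def y_def)
  also have "\<dots> \<le> 56 * ?R"
  proof (cases "B \<le> A")
    case True
    have "7 * A\<^sup>2 / (A * b + B * a) \<le> 56 * ?R"
    proof (cases "A / 2 \<le> g (x + y) - g (x + y/2)")
      case True
      have "A / 4 \<le> a" using av_split(1)[of "1/2" y x] y True by (simp add: a_def)
      moreover have "A / B \<le> ?R" by (simp add: distortion_def A_def B_def)
      ultimately show ?thesis using ratio_bound_near pos by blast
    next
      case False
      let ?D = "g (x - y/4) - g (x - y)"
      have D: "0 < ?D" "?D \<le> 4 * b" using av_split(2)[of "1/4" y x] y by (auto simp: b_def)
      have e: "x - y/4 + 3*y/4 = x + y/2" "x - y/4 - 3*y/4 = x - y" by (auto simp: field_simps)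
      have "(g (x + y/2) - g (x - y/4)) / ?D \<le> ?R" by (simp add: distortion_def e)
      then have "g (x + y/2) - g (x - y/4) \<le> ?R * ?D" using D by (simp add: pos_divide_le_eq)
      moreover have "A / 2 \<le> g (x + y/2) - g x" using False by (simp add: A_def field_simps)
      moreover have "g (x - y/4) < g x" using y by simp
      ultimately have 1: "A / 2 \<le> ?R * ?D" by linarith
      then have "0 < ?R * ?D" using pos by linarith
      then have "0 < ?R" using D zero_less_mult_pos2 by blast
      then have "?R * ?D \<le> ?R * (4 * b)" using D by (intro mult_left_mono) auto
      then have "A \<le> 8 * ?R * b" using 1 by linarith
      then show ?thesis using ratio_bound_far pos by blast
    qed
    then show ?thesis using True by (simp add: max_absorb1)
  next
    case False
    have "7 * B\<^sup>2 / (B * a + A * b) \<le> 56 * ?R"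
    proof (cases "B / 2 \<le> g (x - y/2) - g (x - y)")
      case True
      have "B / 4 \<le> b" using av_split(2)[of "1/2" y x] y True by (simp add: b_def)
      moreover have "B / A \<le> ?R" by (simp add: distortion_def A_def B_def)
      ultimately show ?thesis using ratio_bound_near pos by blast
    next
      case False
      let ?D = "g (x + y) - g (x + y/4)"
      have D: "0 < ?D" "?D \<le> 4 * a" using av_split(1)[of "1/4" y x] y by (auto simp: a_def)
      have e: "x + y/4 + 3*y/4 = x + y" "x + y/4 - 3*y/4 = x - y/2" by (auto simp: field_simps)
      have "(g (x + y/4) - g (x - y/2)) / ?D \<le> ?R" by (simp add: distortion_def e)
      then have "g (x + y/4) - g (x - y/2) \<le> ?R * ?D" using D by (simp add: pos_divide_le_eq)
      moreover have "B / 2 \<le> g x - g (x - y/2)" using False by (simp add: B_def field_simps)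
      moreover have "g x < g (x + y/4)" using y by simp
      ultimately have 1: "B / 2 \<le> ?R * ?D" by linarith
      then have "0 < ?R * ?D" using pos by linarith
      then have "0 < ?R" using D zero_less_mult_pos2 by blast
      then have "?R * ?D \<le> ?R * (4 * a)" using D by (intro mult_left_mono) auto
      then have "B \<le> 8 * ?R * a" using 1 by linarith
      then show ?thesis using ratio_bound_far pos by blast
    qed
    then show ?thesis using False by (simp add: max_absorb2 add.commute)
  qed
  finally show ?thesis .
qed

lemma g_measurable [measurable]: "g \<in> borel_measurable borel"
  using cont by (rule borel_measurable_continuous_onI)

lemma exp_frob_dilatation_BA_integrable:
  assumes q: "0 < q"
    and fin: "(\<integral>\<^sup>+x. \<integral>\<^sup>+t. ennreal (exp (q * distortion x t)) * indicator {0<..<pi/2} t * indicator {0..2*pi} x \<partial>lborel \<partial>lborel) < \<infinity>"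
  shows "(\<integral>\<^sup>+x. \<integral>\<^sup>+y. ennreal (exp (q / 56 * frob_dilatation (BAx (Complex x y)) (BAy (Complex x y))))
     * indicator {0<..<pi/2} y * indicator {0..2*pi} x \<partial>lborel \<partial>lborel) < \<infinity>"
proof -
  define f where "f x t = ennreal (exp (q * distortion x t))" for x t
  have f[measurable]: "case_prod f \<in> borel_measurable (borel \<Otimes>\<^sub>M borel)"
    unfolding f_def distortion_def by measurable
  have pair: "borel_measurable (lborel \<Otimes>\<^sub>M lborel) = borel_measurable (borel \<Otimes>\<^sub>M borel)"
    by (intro measurable_cong_sets sets_pair_measure_cong) auto
  have [measurable]: "case_prod f \<in> borel_measurable (lborel \<Otimes>\<^sub>M lborel)"
    by (simp add: pair f)
  have per: "f (x + 2*pi) t = f x t" for x t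
  proof -
    have "g (x + 2*pi + t) = g (x + t) + 2*pi" for t using per[of "x + t"] by (simp add: algebra_simps)
    from this[of t] this[of 0] this[of "-t"] show ?thesis by (simp add: f_def distortion_def)
  qed
  define J where "J c k = (\<integral>\<^sup>+x. \<integral>\<^sup>+y. f (x + c * y) (k * y) * indicator {0<..<pi/2} y * indicator {0..2*pi} x \<partial>lborel \<partial>lborel)" for c k
  have fin': "J c k < \<infinity>" if "\<bar>c\<bar> \<le> 1" "0 < k" "k \<le> 1" for c k
  proof -
    have "J c k \<le> ennreal (3 / k) * (\<integral>\<^sup>+x. \<integral>\<^sup>+t. f x t * indicator {0<..<pi/2} t * indicator {0..2*pi} x \<partial>lborel \<partial>lborel)"
      unfolding J_def by (rule nn_integral_sheared_le) (use that per in \<open>auto simp: f\<close>)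
    also have "\<dots> < \<infinity>" using fin by (auto simp: f_def ennreal_mult_less_top)
    finally show ?thesis .
  qed
  have bound: "ennreal (exp (q / 56 * frob_dilatation (BAx (Complex x y)) (BAy (Complex x y))))
    \<le> f (x + 0 * y) (1 * y) + f (x + (-1/4) * y) (3/4 * y) + f (x + 1/4 * y) (3/4 * y)" if "0 < y" for x y
  proof -
    let ?M = "max (distortion x y) (max (distortion (x - y/4) (3*y/4)) (distortion (x + y/4) (3*y/4)))"
    have "q / 56 * frob_dilatation (BAx (Complex x y)) (BAy (Complex x y)) \<le> q / 56 * (56 * ?M)"
      using frob_dilatation_BA_le[of "Complex x y"] that q by (intro mult_left_mono) auto
    then have "exp (q / 56 * frob_dilatation (BAx (Complex x y)) (BAy (Complex x y))) \<le> exp (q * ?M)" by simp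
    then have "ennreal (exp (q / 56 * frob_dilatation (BAx (Complex x y)) (BAy (Complex x y)))) \<le> ennreal (exp (q * ?M))"
      by (rule ennreal_leI)
    also have "\<dots> \<le> f x y + f (x - y/4) (3*y/4) + f (x + y/4) (3*y/4)"
      by (auto simp: f_def max_def intro: add_increasing add_increasing2)
    finally show ?thesis by simp
  qed
  have "(\<integral>\<^sup>+x. \<integral>\<^sup>+y. ennreal (exp (q / 56 * frob_dilatation (BAx (Complex x y)) (BAy (Complex x y))))
     * indicator {0<..<pi/2} y * indicator {0..2*pi} x \<partial>lborel \<partial>lborel)
    \<le> (\<integral>\<^sup>+x. \<integral>\<^sup>+y. f (x + 0 * y) (1 * y) * indicator {0<..<pi/2} y * indicator {0..2*pi} x
         + f (x + (-1/4) * y) (3/4 * y) * indicator {0<..<pi/2} y * indicator {0..2*pi} x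
         + f (x + 1/4 * y) (3/4 * y) * indicator {0<..<pi/2} y * indicator {0..2*pi} x \<partial>lborel \<partial>lborel)"
    using bound by (intro nn_integral_mono) (auto split: split_indicator)
  also have "\<dots> = J 0 1 + J (-1/4) (3/4) + J (1/4) (3/4)"
    unfolding J_def by (simp add: nn_integral_add)
  also have "\<dots> < \<infinity>"
    using fin'[of 0 1] fin'[of "-1/4" "3/4"] fin'[of "1/4" "3/4"] by simp
  finally show ?thesis .
qed

end

section \<open>The extension to the disk and its derivative\<close>

lemma exp_i_eq_iff:
  "exp (\<i> * w) = exp (\<i> * w') \<longleftrightarrow> (\<exists>n::int. w = w' + of_real (2 * pi * of_int n))"
proof -
  have "(\<i> * w = \<i> * w' + (of_int (2 * n) * pi) * \<i>) \<longleftrightarrow> w = w' + of_real (2 * pi * of_int n)" for n :: int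
  proof -
    have "\<i> * w' + (of_int (2 * n) * pi) * \<i> = \<i> * (w' + of_real (2 * pi * of_int n))"
      by (simp add: algebra_simps)
    then show ?thesis by simp
  qed
  then show ?thesis by (simp add: exp_eq)
qed

lemma Im_eq_of_exp: "exp (\<i> * w) = z \<Longrightarrow> Im w = - ln (norm z)"
  by auto

text \<open>
  Near \<open>exp (\<i> w0)\<close> a continuous inverse of \<open>w \<mapsto> exp (\<i> w)\<close> with value \<open>w0\<close> there. The
  principal branch alone would not do, since the disk map has to be studied on its slit too.
\<close>

definition log_branch :: "complex \<Rightarrow> complex \<Rightarrow> complex" where
  "log_branch w0 z = w0 - \<i> * Ln (z / exp (\<i> * w0))"

lemma exp_log_branch: "z \<noteq> 0 \<Longrightarrow> exp (\<i> * log_branch w0 z) = z"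
  by (simp add: log_branch_def algebra_simps exp_add)

lemma log_branch_self [simp]: "log_branch w0 (exp (\<i> * w0)) = w0"
  by (simp add: log_branch_def)

lemma has_field_derivative_log_branch:
  "(log_branch w0 has_field_derivative 1 / (\<i> * exp (\<i> * w0))) (at (exp (\<i> * w0)))"
  unfolding log_branch_def by (auto intro!: derivative_eq_intros simp: field_simps)

lemma isCont_log_branch: "isCont (log_branch w0) (exp (\<i> * w0))"
  using has_field_derivative_log_branch DERIV_isCont by blast

lemma diff_map_mult: "diff_map (k * diff_map a b p) (k * diff_map a b (\<i> * p)) v = k * diff_map a b (v * p)"
  by (simp add: diff_map_def complex_eq_iff algebra_simps)

lemma jac_diff_map: "jac (k * diff_map a b p) (k * diff_map a b (\<i> * p)) = (norm k)\<^sup>2 * (norm p)\<^sup>2 * jac a b"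
  unfolding cmod_power2 by (simp add: diff_map_def jac_def power2_eq_square algebra_simps)

text \<open>
  Conformal changes of variables, before and after a map, do not change its dilatation.
\<close>

lemma frob_dilatation_diff_map:
  assumes "k \<noteq> 0" "p \<noteq> 0"
  shows "frob_dilatation (k * diff_map a b p) (k * diff_map a b (\<i> * p)) = frob_dilatation a b"
proof -
  have "(norm (k * diff_map a b p))\<^sup>2 + (norm (k * diff_map a b (\<i> * p)))\<^sup>2 = (norm k)\<^sup>2 * (norm p)\<^sup>2 * ((norm a)\<^sup>2 + (norm b)\<^sup>2)"
    unfolding cmod_power2 norm_mult power_mult_distrib by (simp add: diff_map_def power2_eq_square algebra_simps)
  then show ?thesis unfolding frob_dilatation_def jac_diff_map using assms by simp
qed

lemma continuous_diff_map [continuous_intros]: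
  assumes "continuous F a" "continuous F b" "continuous F v"
  shows "continuous F (\<lambda>z. diff_map (a z) (b z) (v z))"
  unfolding diff_map_def
  by (intro continuous_intros bounded_linear.continuous[OF bounded_linear_Re] bounded_linear.continuous[OF bounded_linear_Im] assms)

lemma filterlim_neg_ln_norm: "filterlim (\<lambda>z::complex. - ln (norm z)) at_top (at 0)"
proof -
  have "filterlim (\<lambda>z::complex. norm z) (at_right 0) (at 0)"
    unfolding filterlim_at by (auto simp: eventually_at intro!: tendsto_eq_intros exI[of _ 1])
  from filterlim_compose[OF ln_at_0 this] show ?thesis
    by (simp add: filterlim_uminus_at_top)
qed

context circle_lift begin

definition disk_ext :: "complex \<Rightarrow> complex" where
  "disk_ext z = (if z = 0 then 0 else exp (\<i> * BA (- \<i> * Ln z)))"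

lemma exp_i_Ln: "z \<noteq> 0 \<Longrightarrow> exp (\<i> * (- \<i> * Ln z)) = z"
  by (simp add: mult.assoc[symmetric])

text \<open>
  Any logarithm may be used in place of the principal one, since \<open>BA\<close> commutes with the translation
  by \<open>2\<pi>\<close>.
\<close>

lemma disk_ext_exp: "disk_ext (exp (\<i> * w)) = exp (\<i> * BA w)"
proof -
  have "exp (\<i> * (- \<i> * Ln (exp (\<i> * w)))) = exp (\<i> * w)" by (rule exp_i_Ln) simp
  then obtain n :: int where "- \<i> * Ln (exp (\<i> * w)) = w + of_real (2 * pi * of_int n)"
    unfolding exp_i_eq_iff by blast
  then have "disk_ext (exp (\<i> * w)) = exp (\<i> * (BA w + of_real (2 * pi * of_int n)))"
    by (simp only: disk_ext_def BA_add_2pi_int) simp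
  also have "\<dots> = exp (\<i> * BA w)" unfolding exp_i_eq_iff by blast
  finally show ?thesis .
qed

lemma disk_ext_log_branch: "z \<noteq> 0 \<Longrightarrow> disk_ext z = exp (\<i> * BA (log_branch w0 z))"
  using disk_ext_exp[of "log_branch w0 z"] by (simp add: exp_log_branch)

lemma BAxy_add_2pi_int:
  "BAx (w + of_real (2*pi * of_int n)) = BAx w" "BAy (w + of_real (2*pi * of_int n)) = BAy w"
proof -
  have e: "Re (w + of_real (2*pi * of_int n)) = Re w + 2*pi * of_int n" "Im (w + of_real (2*pi * of_int n)) = Im w"
    by simp_all
  have a: "x + 2*pi * of_int n + y = (x + y) + 2*pi * of_int n" "x + 2*pi * of_int n - y = (x - y) + 2*pi * of_int n" for x y
    by simp_all
  show "BAx (w + of_real (2*pi * of_int n)) = BAx w" "BAy (w + of_real (2*pi * of_int n)) = BAy w"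
    unfolding BAx_def BAy_def e a g_add_2pi_int av_add_2pi_int by simp_all
qed

lemma BAxy_eq_of_exp:
  assumes "exp (\<i> * w) = z"
  shows "BAx (- \<i> * Ln z) = BAx w" "BAy (- \<i> * Ln z) = BAy w"
proof -
  have "z \<noteq> 0" using assms by auto
  then have "exp (\<i> * (- \<i> * Ln z)) = exp (\<i> * w)" using exp_i_Ln assms by simp
  then obtain n :: int where "- \<i> * Ln z = w + of_real (2 * pi * of_int n)"
    unfolding exp_i_eq_iff by blast
  then show "BAx (- \<i> * Ln z) = BAx w" "BAy (- \<i> * Ln z) = BAy w"
    by (simp_all only: BAxy_add_2pi_int)
qed

text \<open>
  The derivative of the disk map in the direction \<open>u\<close>, from the chain rule for
  \<open>z \<mapsto> w = - \<i> Ln z\<close>, \<open>BA\<close> and \<open>w \<mapsto> exp (\<i> w)\<close>. The value at the origin is left as a parameter \<open>c\<close>,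
  to be the limit of \<open>disk_ext z / z\<close>.
\<close>

definition disk_ext_deriv :: "complex \<Rightarrow> complex \<Rightarrow> complex \<Rightarrow> complex" where
  "disk_ext_deriv c u z = (if z = 0 then c * u
     else \<i> * disk_ext z * diff_map (BAx (- \<i> * Ln z)) (BAy (- \<i> * Ln z)) (u / (\<i> * z)))"

lemma disk_ext_nonzero: "z \<noteq> 0 \<Longrightarrow> disk_ext z \<noteq> 0"
  by (simp add: disk_ext_def)

lemma has_derivative_disk_ext_nonzero:
  assumes z: "z \<noteq> 0" "norm z < 1"
  shows "(disk_ext has_derivative diff_map (disk_ext_deriv c 1 z) (disk_ext_deriv c \<i> z)) (at z)"
proof -
  define w where "w = - \<i> * Ln z"
  have w: "exp (\<i> * w) = z" using exp_i_Ln[OF z(1)] by (simp add: w_def)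
  have "Im w > 0" using Im_eq_of_exp[OF w] z by simp
  have br: "(log_branch w has_derivative (\<lambda>v. v / (\<i> * z))) (at z)"
  proof -
    have "(*) (1 / (\<i> * z)) = (\<lambda>v. v / (\<i> * z))" by auto
    then show ?thesis
      using has_field_derivative_log_branch[of w] unfolding w has_field_derivative_def by (simp only:)
  qed
  have lb: "log_branch w z = w" using log_branch_self[of w] w by simp
  have BA': "(BA has_derivative diff_map (BAx w) (BAy w)) (at (log_branch w z))"
    unfolding lb by (rule has_derivative_BA[OF \<open>Im w > 0\<close>])
  have "((\<lambda>z. BA (log_branch w z)) has_derivative (\<lambda>v. diff_map (BAx w) (BAy w) (v / (\<i> * z)))) (at z)"
    by (rule has_derivative_compose[OF br BA'])
  moreover have "((\<lambda>y. exp (\<i> * y)) has_derivative (\<lambda>v. \<i> * exp (\<i> * BA w) * v)) (at (BA (log_branch w z)))"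
    unfolding has_field_derivative_def[symmetric] lb by (auto intro!: derivative_eq_intros)
  ultimately have "((\<lambda>z. exp (\<i> * BA (log_branch w z))) has_derivative
      (\<lambda>v. \<i> * exp (\<i> * BA w) * diff_map (BAx w) (BAy w) (v / (\<i> * z)))) (at z)"
    by (rule has_derivative_compose)
  moreover have "exp (\<i> * BA w) = disk_ext z" using disk_ext_exp[of w] w by simp
  moreover have "(\<lambda>v. \<i> * disk_ext z * diff_map (BAx w) (BAy w) (v / (\<i> * z))) = diff_map (disk_ext_deriv c 1 z) (disk_ext_deriv c \<i> z)"
    using diff_map_mult[of "\<i> * disk_ext z" "BAx w" "BAy w" "1 / (\<i> * z)"] z
    by (auto simp: disk_ext_deriv_def fun_eq_iff w_def)
  ultimately have "((\<lambda>z. exp (\<i> * BA (log_branch w z))) has_derivative diff_map (disk_ext_deriv c 1 z) (disk_ext_deriv c \<i> z)) (at z)"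
    by simp
  then show ?thesis
    by (rule has_derivative_transform_within_open[where s="- {0}"])
       (use z disk_ext_log_branch in \<open>auto simp: open_Compl\<close>)
qed

lemma isCont_disk_ext_nonzero:
  assumes "z \<noteq> 0" shows "isCont disk_ext z"
proof -
  define w where "w = - \<i> * Ln z"
  have w: "exp (\<i> * w) = z" using exp_i_Ln[OF assms] by (simp add: w_def)
  have "isCont (log_branch w) z" using isCont_log_branch[of w] w by simp
  moreover have "isCont BA v" for v using continuous_on_BA[of UNIV] by (simp add: continuous_on_eq_continuous_at)
  ultimately have "isCont (\<lambda>z. exp (\<i> * BA (log_branch w z))) z"
    by (intro continuous_intros isCont_o2[of _ "log_branch w" BA]) auto
  moreover have "\<forall>\<^sub>F z in nhds z. exp (\<i> * BA (log_branch w z)) = disk_ext z"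
    using disk_ext_log_branch eventually_nhds_in_open[of "- {0}" z] assms
    by (auto elim!: eventually_mono simp: open_Compl)
  ultimately show ?thesis by (simp add: isCont_cong)
qed

lemma isCont_disk_ext_deriv_nonzero:
  assumes z: "z \<noteq> 0" "norm z < 1"
  shows "isCont (disk_ext_deriv c u) z"
proof -
  define w where "w = - \<i> * Ln z"
  have w: "exp (\<i> * w) = z" using exp_i_Ln[OF z(1)] by (simp add: w_def)
  have pos: "Im w > 0" using Im_eq_of_exp[OF w] z by simp
  have br: "isCont (log_branch w) z" using isCont_log_branch[of w] w by simp
  have lb: "log_branch w z = w" using log_branch_self[of w] w by simp
  have op: "open {w. 0 < Im w}" by (simp add: open_halfspace_Im_gt)
  have "isCont BAx (log_branch w z)" "isCont BAy (log_branch w z)"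
    unfolding lb using continuous_on_BAx continuous_on_BAy pos op by (auto simp: continuous_on_eq_continuous_at)
  then have "isCont (\<lambda>z. \<i> * disk_ext z * diff_map (BAx (log_branch w z)) (BAy (log_branch w z)) (u / (\<i> * z))) z"
    using z by (intro continuous_intros isCont_disk_ext_nonzero isCont_o2[OF br]) auto
  moreover have "\<forall>\<^sub>F z in nhds z. \<i> * disk_ext z * diff_map (BAx (log_branch w z)) (BAy (log_branch w z)) (u / (\<i> * z)) = disk_ext_deriv c u z"
  proof (rule eventually_mono)
    show "\<forall>\<^sub>F x in nhds z. x \<in> - {0}" using z by (intro eventually_nhds_in_open) auto
    fix x :: complex assume x: "x \<in> - {0}"
    then have "exp (\<i> * log_branch w x) = x" by (simp add: exp_log_branch)
    with x show "\<i> * disk_ext x * diff_map (BAx (log_branch w x)) (BAy (log_branch w x)) (u / (\<i> * x)) = disk_ext_deriv c u x"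
      unfolding disk_ext_deriv_def BAxy_eq_of_exp[OF \<open>exp (\<i> * log_branch w x) = x\<close>] by simp
  qed
  ultimately show ?thesis by (simp add: isCont_cong)
qed

text \<open>
  As \<open>z\<close> tends to \<open>0\<close>, the height of \<open>w = - \<i> Ln z\<close> tends to infinity. There \<open>BA w - w\<close> tends to a
  real constant \<open>m\<close>, so the quotient \<open>disk_ext z / z = exp (\<i> (BA w - w))\<close> tends to \<open>c = exp (\<i> m)\<close>; and
  the derivative of \<open>BA\<close> tends to the identity, so the derivative of the disk map tends to the
  multiplication by \<open>c\<close>.
\<close>

lemma disk_ext_near_0:
  obtains c where "c \<noteq> 0" "((\<lambda>z. disk_ext z / z) \<longlongrightarrow> c) (at 0)"
    "\<And>u. (disk_ext_deriv c u \<longlongrightarrow> c * u) (at 0)"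
proof -
  obtain m C where C: "0 \<le> C"
    and A: "\<And>w. 1 \<le> Im w \<Longrightarrow> norm (BA w - w - of_real m) \<le> C / Im w"
    and Ax: "\<And>w. 1 \<le> Im w \<Longrightarrow> norm (BAx w - 1) \<le> C / Im w"
    and Ay: "\<And>w. 1 \<le> Im w \<Longrightarrow> norm (BAy w - \<i>) \<le> C / Im w"
    by (rule BA_asymptotics, rule that)
  define W where "W z = - \<i> * Ln z" for z
  have ImW: "Im (W z) = - ln (norm z)" if "z \<noteq> 0" for z
    using that by (simp add: W_def)
  have lim0: "((\<lambda>z::complex. K / (- ln (norm z))) \<longlongrightarrow> 0) (at 0)" for K :: real
    by (rule real_tendsto_divide_at_top[OF tendsto_const filterlim_neg_ln_norm])
  have ev: "\<forall>\<^sub>F z in at 0. z \<noteq> 0 \<and> 1 \<le> Im (W z)"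
  proof -
    have "\<forall>\<^sub>F z::complex in at 0. 1 \<le> - ln (norm z)"
      using filterlim_neg_ln_norm unfolding filterlim_at_top by blast
    moreover have "\<forall>\<^sub>F z::complex in at 0. z \<noteq> 0" by (simp add: eventually_at_filter)
    ultimately show ?thesis by eventually_elim (auto simp: ImW)
  qed
  define c where "c = exp (\<i> * of_real m)"
  have "((\<lambda>z. BA (W z) - W z - of_real m) \<longlongrightarrow> 0) (at 0)"
  proof (rule Lim_null_comparison[OF _ lim0[of C]])
    show "\<forall>\<^sub>F z in at 0. norm (BA (W z) - W z - of_real m) \<le> C / - ln (norm z)"
      using ev
    proof eventually_elim
      case (elim z)
      show ?case using A[OF conjunct2[OF elim]] unfolding ImW[OF conjunct1[OF elim]] .
    qed
  qed
  then have "((\<lambda>z. BA (W z) - W z) \<longlongrightarrow> of_real m) (at 0)" by (simp add: LIM_zero_iff)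
  then have "((\<lambda>z. exp (\<i> * (BA (W z) - W z))) \<longlongrightarrow> c) (at 0)"
    unfolding c_def by (intro tendsto_intros)
  moreover have "\<forall>\<^sub>F z in at 0. exp (\<i> * (BA (W z) - W z)) = disk_ext z / z"
    using ev
  proof eventually_elim
    case (elim z)
    then have "exp (\<i> * W z) = z" unfolding W_def using exp_i_Ln by blast
    then have "exp (\<i> * (BA (W z) - W z)) = exp (\<i> * BA (W z)) / z"
      by (simp add: right_diff_distrib exp_diff)
    then show ?case using elim by (simp add: disk_ext_def W_def)
  qed
  ultimately have q: "((\<lambda>z. disk_ext z / z) \<longlongrightarrow> c) (at 0)" by (rule Lim_transform_eventually)
  have "(disk_ext_deriv c u \<longlongrightarrow> c * u) (at 0)" for u
  proof -
    define R where "R z = \<i> * z * diff_map (BAx (W z)) (BAy (W z)) (u / (\<i> * z))" for z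
    have "((\<lambda>z. R z - u) \<longlongrightarrow> 0) (at 0)"
    proof (rule Lim_null_comparison[OF _ lim0[of "norm u * (2 * C)"]])
      show "\<forall>\<^sub>F z in at 0. norm (R z - u) \<le> norm u * (2 * C) / - ln (norm z)"
        using ev
      proof eventually_elim
        case (elim z)
        define p where "p = u / (\<i> * z)"
        have u: "u = \<i> * z * p" using elim by (simp add: p_def)
        have np: "norm z * norm p = norm u" unfolding u by (simp add: norm_mult)
        have "R z = \<i> * z * diff_map (BAx (W z)) (BAy (W z)) p" by (simp add: R_def p_def)
        then have "R z - u = \<i> * z * (diff_map (BAx (W z)) (BAy (W z)) p - p)"
          using u by (simp add: right_diff_distrib)
        also have "diff_map (BAx (W z)) (BAy (W z)) p - p = Re p *\<^sub>R (BAx (W z) - 1) + Im p *\<^sub>R (BAy (W z) - \<i>)"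
          by (simp add: diff_map_def complex_eq_iff algebra_simps)
        finally have "norm (R z - u) = norm z * norm (Re p *\<^sub>R (BAx (W z) - 1) + Im p *\<^sub>R (BAy (W z) - \<i>))"
          by (simp add: norm_mult)
        also have "\<dots> \<le> norm z * (norm p * (C / Im (W z)) + norm p * (C / Im (W z)))"
        proof (intro mult_left_mono order_trans[OF norm_triangle_ineq] add_mono)
          show "norm (Re p *\<^sub>R (BAx (W z) - 1)) \<le> norm p * (C / Im (W z))"
            unfolding norm_scaleR using Ax[of "W z"] elim by (intro mult_mono) (auto simp: abs_Re_le_cmod)
          show "norm (Im p *\<^sub>R (BAy (W z) - \<i>)) \<le> norm p * (C / Im (W z))"
            unfolding norm_scaleR using Ay[of "W z"] elim by (intro mult_mono) (auto simp: abs_Im_le_cmod)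
        qed auto
        also have "\<dots> = (norm z * norm p) * (2 * C) / Im (W z)" by (simp add: field_simps)
        also have "\<dots> = norm u * (2 * C) / - ln (norm z)" using elim np by (simp add: ImW)
        finally show ?case .
      qed
    qed
    then have "(R \<longlongrightarrow> u) (at 0)" by (simp add: LIM_zero_iff)
    from tendsto_mult[OF q this] have "((\<lambda>z. disk_ext z / z * R z) \<longlongrightarrow> c * u) (at 0)" .
    moreover have "\<forall>\<^sub>F z in at 0. disk_ext z / z * R z = disk_ext_deriv c u z"
      using ev by eventually_elim (auto simp: R_def disk_ext_deriv_def W_def)
    ultimately show ?thesis by (rule Lim_transform_eventually)
  qed
  moreover have "c \<noteq> 0" by (simp add: c_def)
  ultimately show ?thesis using that q by blast
qed

lemma disk_ext_C1:
  obtains Hx Hy where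
    "\<And>z. z \<in> ball 0 1 \<Longrightarrow> (disk_ext has_derivative diff_map (Hx z) (Hy z)) (at z)"
    "continuous_on (ball 0 1) Hx" "continuous_on (ball 0 1) Hy"
    "\<And>z. z \<in> ball 0 1 \<Longrightarrow> 0 < jac (Hx z) (Hy z)"
    "\<And>w. 0 < Im w \<Longrightarrow> frob_dilatation (Hx (exp (\<i> * w))) (Hy (exp (\<i> * w))) = frob_dilatation (BAx w) (BAy w)"
proof -
  obtain c where c: "c \<noteq> 0" "((\<lambda>z. disk_ext z / z) \<longlongrightarrow> c) (at 0)"
    "\<And>u. (disk_ext_deriv c u \<longlongrightarrow> c * u) (at 0)" by (rule disk_ext_near_0, rule that)
  let ?Hx = "disk_ext_deriv c 1" and ?Hy = "disk_ext_deriv c \<i>"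
  have form: "?Hx z = \<i> * disk_ext z * diff_map (BAx w) (BAy w) (1 / (\<i> * z))"
      "?Hy z = \<i> * disk_ext z * diff_map (BAx w) (BAy w) (\<i> * (1 / (\<i> * z)))" if "exp (\<i> * w) = z" for w z
    using BAxy_eq_of_exp[OF that] that by (auto simp: disk_ext_deriv_def)
  show ?thesis
  proof (rule that[of ?Hx ?Hy])
    fix z :: complex assume z: "z \<in> ball 0 1"
    show "(disk_ext has_derivative diff_map (?Hx z) (?Hy z)) (at z)"
    proof (cases "z = 0")
      case True
      have "(disk_ext has_field_derivative c) (at 0)"
        using c(2) by (simp add: has_field_derivative_iff disk_ext_def[of 0])
      then have "(disk_ext has_derivative (\<lambda>v. c * v)) (at 0)" by (simp add: has_field_derivative_def)
      moreover have "(\<lambda>v. c * v) = diff_map (?Hx 0) (?Hy 0)"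
        by (simp add: fun_eq_iff diff_map_def disk_ext_deriv_def complex_eq_iff algebra_simps)
      ultimately show ?thesis using True by simp
    qed (use z has_derivative_disk_ext_nonzero in simp)
    show "0 < jac (?Hx z) (?Hy z)"
    proof (cases "z = 0")
      case True
      have "0 < (Re c)\<^sup>2 + (Im c)\<^sup>2" using c(1) by (simp add: complex_neq_0)
      then show ?thesis using True by (simp add: disk_ext_deriv_def jac_def power2_eq_square)
    next
      case False
      define w where "w = - \<i> * Ln z"
      have w: "exp (\<i> * w) = z" using exp_i_Ln[OF False] by (simp add: w_def)
      then have "Im w > 0" using Im_eq_of_exp[OF w] z False by simp
      then show ?thesis unfolding form[OF w] jac_diff_map
        using jac_BA_pos disk_ext_nonzero False by simp
    qed
  next
    show "continuous_on (ball 0 1) ?Hx" "continuous_on (ball 0 1) ?Hy"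
    proof -
      have "isCont (disk_ext_deriv c u) z" if "z \<in> ball 0 1" for u z
        using c(3)[of u] isCont_disk_ext_deriv_nonzero[of z c u] that
        by (cases "z = 0") (auto simp: isCont_def disk_ext_deriv_def[of c u 0])
      then show "continuous_on (ball 0 1) ?Hx" "continuous_on (ball 0 1) ?Hy"
        by (auto intro: continuous_at_imp_continuous_on)
    qed
  next
    fix w :: complex
    show "frob_dilatation (?Hx (exp (\<i> * w))) (?Hy (exp (\<i> * w))) = frob_dilatation (BAx w) (BAy w)"
      unfolding form[OF refl, of w] by (rule frob_dilatation_diff_map) (simp_all add: disk_ext_nonzero)
  qed
qed

end

section \<open>The extension is an orientation-preserving homeomorphism\<close>

context circle_lift begin

lemma disk_ext_0 [simp]: "disk_ext 0 = 0" by (simp add: disk_ext_def)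

lemma isCont_disk_ext: "isCont disk_ext z"
proof (cases "z = 0")
  case True
  obtain Hx Hy where "\<And>z. z \<in> ball 0 1 \<Longrightarrow> (disk_ext has_derivative diff_map (Hx z) (Hy z)) (at z)"
    by (rule disk_ext_C1, rule that)
  from has_derivative_continuous[OF this[of 0]] True show ?thesis by simp
qed (rule isCont_disk_ext_nonzero)

lemma continuous_on_disk_ext [continuous_intros]: "continuous_on S f \<Longrightarrow> continuous_on S (\<lambda>z. disk_ext (f z))"
  by (rule continuous_on_compose2[of UNIV disk_ext]) (auto intro: continuous_at_imp_continuous_on isCont_disk_ext)

lemma disk_ext_cis: "disk_ext (cis \<theta>) = cis (g \<theta>)"
  using disk_ext_exp[of "of_real \<theta>"] by (simp add: BA_real cis_conv_exp)

lemma norm_disk_ext_ball: assumes "norm z < 1" shows "norm (disk_ext z) < 1"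
proof (cases "z = 0")
  case False
  define w where "w = - \<i> * Ln z"
  have w: "exp (\<i> * w) = z" using exp_i_Ln[OF False] by (simp add: w_def)
  then have "Im w > 0" using Im_eq_of_exp[OF w] assms False by simp
  then show ?thesis using disk_ext_exp[of w] Im_BA_pos w by simp
qed simp

lemma norm_disk_ext_sphere: assumes "norm z = 1" shows "norm (disk_ext z) = 1"
proof -
  obtain \<theta> where "z = cis \<theta>"
    using assms complex_unimodular_polar[OF assms] by (metis cis.code complex_eq_iff complex.sel)
  then show ?thesis by (simp add: disk_ext_cis)
qed

lemma inj_on_disk_ext: "inj_on disk_ext (cball 0 1)"
proof (rule inj_onI)
  fix z z' assume z: "z \<in> cball 0 1" "z' \<in> cball 0 1" and eq: "disk_ext z = disk_ext z'"
  show "z = z'"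
  proof (cases "z = 0 \<or> z' = 0")
    case True
    then show ?thesis using eq disk_ext_nonzero by (metis disk_ext_0)
  next
    case False
    define w w' where "w = - \<i> * Ln z" and "w' = - \<i> * Ln z'"
    have w: "exp (\<i> * w) = z" "exp (\<i> * w') = z'"
      using exp_i_Ln False unfolding w_def w'_def by blast+
    have pos: "0 \<le> Im w" "0 \<le> Im w'"
      using Im_eq_of_exp[OF w(1)] Im_eq_of_exp[OF w(2)] z False by auto
    have "exp (\<i> * BA w) = exp (\<i> * BA w')"
      using eq disk_ext_exp[of w] disk_ext_exp[of w'] w by simp
    then obtain n :: int where "BA w = BA w' + of_real (2 * pi * of_int n)"
      unfolding exp_i_eq_iff by blast
    also have "\<dots> = BA (w' + of_real (2 * pi * of_int n))" by (rule BA_add_2pi_int[symmetric])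
    finally have "w = w' + of_real (2 * pi * of_int n)"
      by (rule BA_inj) (use pos in auto)
    then have "exp (\<i> * w) = exp (\<i> * w')" unfolding exp_i_eq_iff by blast
    with w show ?thesis by simp
  qed
qed

text \<open>
  The image of the open disk is open by invariance of domain. It is also relatively closed: since the
  circle is mapped into itself, it is the part of the compact image of the closed disk that lies in the
  open disk.
\<close>

lemma disk_ext_ball: "disk_ext ` ball 0 1 = ball 0 1"
proof -
  let ?B = "ball 0 1 :: complex set"
  have sub: "disk_ext ` ?B \<subseteq> ?B" using norm_disk_ext_ball by auto
  have inj: "inj_on disk_ext ?B" by (rule inj_on_subset[OF inj_on_disk_ext]) auto
  have "open (disk_ext ` ?B)"
    by (rule invariance_of_domain[OF _ _ inj]) (auto intro!: continuous_intros)
  then have op: "openin (top_of_set ?B) (disk_ext ` ?B)" using sub by (simp add: open_subset)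
  have eq: "disk_ext ` ?B = ?B \<inter> disk_ext ` cball 0 1"
  proof -
    have "z \<in> ?B" if "z \<in> cball 0 1" "disk_ext z \<in> ?B" for z
      using that norm_disk_ext_sphere[of z] by (cases "norm z = 1") auto
    then show ?thesis using sub by auto
  qed
  have "compact (disk_ext ` cball 0 1)"
    by (intro compact_continuous_image continuous_intros) auto
  then have cl: "closedin (top_of_set ?B) (disk_ext ` ?B)"
    unfolding eq by (intro closedin_closed_Int compact_imp_closed)
  have "connected ?B" by simp
  then show ?thesis using op cl unfolding connected_clopen by (auto dest: spec[of _ "disk_ext ` ?B"])
qed

lemma disk_ext_cball: "disk_ext ` cball 0 1 = cball 0 1"
proof
  show "disk_ext ` cball 0 1 \<subseteq> cball 0 1"
    using norm_disk_ext_ball norm_disk_ext_sphere by (force simp: le_less)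
  have "closed (disk_ext ` cball 0 1)"
    by (intro compact_imp_closed compact_continuous_image continuous_intros) auto
  moreover have "ball 0 1 \<subseteq> disk_ext ` cball 0 1" using disk_ext_ball image_mono[OF ball_subset_cball] by metis
  ultimately have "closure (ball 0 1) \<subseteq> disk_ext ` cball 0 1" by (intro closure_minimal)
  then show "cball 0 1 \<subseteq> disk_ext ` cball 0 1" by simp
qed

lemma disk_ext_homeomorphism: obtains G where "homeomorphism (cball 0 1) (cball 0 1) disk_ext G"
proof -
  have "\<exists>G. homeomorphism (cball 0 1) (cball 0 1) disk_ext G"
    by (rule homeomorphism_compact[OF _ _ disk_ext_cball inj_on_disk_ext]) (auto intro!: continuous_intros)
  then show ?thesis using that by blast
qed

text \<open>
  Moving the centre to \<open>0\<close> and enlarging the radius to \<open>1\<close> carries the image curve to the boundary curve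
  \<open>t \<mapsto> cis (g (2\<pi>t))\<close>, and injectivity keeps it off the image of the moving centre. The boundary curve
  is deformed to the unit circle by interpolating linearly between \<open>g\<close> and the identity; the curves
  stay closed because \<open>g (2\<pi>) = g 0 + 2\<pi>\<close>.
\<close>

lemma winding_number_disk_ext:
  assumes r: "0 < r" and sub: "cball z r \<subseteq> ball 0 1"
  shows "winding_number (disk_ext \<circ> circlepath z r) (disk_ext z) = 1"
proof -
  have zr: "norm z + r < 1" using sub r by (simp add: cball_subset_ball_iff)
  let ?p = "\<lambda>t. disk_ext (circlepath z r t) - disk_ext z"
  let ?q = "\<lambda>t. disk_ext (circlepath 0 1 t)"
  define e where "e t = exp (2 * of_real pi * \<i> * of_real t)" for t :: real
  have circ: "circlepath c s t = c + of_real s * e t" for c s t by (simp add: circlepath e_def)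
  have ne: "norm (e t) = 1" for t by (simp add: e_def)
  have e01: "e 0 = 1" "e 1 = 1" by (simp_all add: e_def)
  have ec [continuous_intros]: "continuous_on S f \<Longrightarrow> continuous_on S (\<lambda>x. e (f x))" for S and f :: "real \<times> real \<Rightarrow> real"
    unfolding e_def by (intro continuous_intros)
  have h1: "homotopic_loops (- {0}) ?p ?q"
    unfolding homotopic_loops
  proof (intro exI conjI ballI)
    let ?h = "\<lambda>y. disk_ext (of_real (1 - fst y) * z + of_real ((1 - fst y) * r + fst y) * e (snd y)) - disk_ext (of_real (1 - fst y) * z)"
    show "continuous_on ({0..1} \<times> {0..1}) ?h" by (intro continuous_intros)
    show "?h \<in> ({0..1} \<times> {0..1}) \<rightarrow> - {0}"
    proof (rule Pi_I, clarsimp)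
      fix s t :: real assume s: "0 \<le> s" "s \<le> 1"
      let ?a = "(1 - of_real s) * z" and ?R = "(1 - s) * r + s"
      assume eq: "disk_ext ((1 - of_real s) * z + ((1 - of_real s) * of_real r + of_real s) * e t) = disk_ext ?a"
      have cR: "(1 - of_real s) * of_real r + of_real s = (of_real ?R :: complex)" by simp
      have Rpos: "0 < ?R"
      proof (cases "s = 1")
        case False then have "0 < (1 - s) * r" using s r by simp
        then show ?thesis using s by linarith
      qed simp
      have na: "norm ?a = (1 - s) * norm z"
      proof -
        have "1 - of_real s = (of_real (1 - s) :: complex)" by simp
        then show ?thesis unfolding norm_mult using s by (simp only: norm_of_real abs_of_nonneg diff_ge_0_iff_ge)
      qed
      have "norm (?a + of_real ?R * e t) \<le> norm ?a + norm (of_real ?R * e t)" by (rule norm_triangle_ineq)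
      also have "\<dots> = (1 - s) * norm z + ?R" using Rpos by (simp add: na norm_mult[of "of_real ((1 - s) * r + s)"] ne norm_of_real del: of_real_add of_real_mult of_real_diff)
      also have "\<dots> = (1 - s) * (norm z + r) + s" by (simp add: algebra_simps)
      also have "\<dots> \<le> (1 - s) * 1 + s" using zr s by (intro add_right_mono mult_left_mono) auto
      finally have 1: "?a + of_real ?R * e t \<in> cball 0 1" by simp
      have "(1 - s) * norm z \<le> 1 * 1" using zr r s by (intro mult_mono) auto
      then have 2: "?a \<in> cball 0 1" by (simp add: na)
      have "?a + of_real ?R * e t = ?a"
        by (rule inj_onD[OF inj_on_disk_ext _ 1 2]) (use eq in \<open>simp only: cR\<close>)
      then have "norm (of_real ?R * e t) = 0" by simp
      then show False using Rpos unfolding norm_mult norm_of_real ne by simp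
    qed
    show "?h (0, t) = ?p t" for t by (simp add: circ)
    show "?h (1, t) = ?q t" for t by (simp add: circ)
    show "pathfinish (?h \<circ> Pair s) = pathstart (?h \<circ> Pair s)" for s
      by (simp add: pathfinish_def pathstart_def e01)
  qed
  have h2: "homotopic_loops (- {0}) ?q (circlepath 0 1)"
    unfolding homotopic_loops
  proof (intro exI conjI ballI)
    let ?h = "\<lambda>y. cis ((1 - fst y) * g (2 * pi * snd y) + fst y * (2 * pi * snd y))"
    show "continuous_on ({0..1} \<times> {0..1}) ?h" by (intro continuous_intros)
    show "?h \<in> ({0..1} \<times> {0..1}) \<rightarrow> - {0}" by auto
    have e_cis: "e t = cis (2 * pi * t)" for t by (simp add: e_def cis_conv_exp mult_ac)
    show "?h (0, t) = ?q t" for t by (simp add: circ e_cis disk_ext_cis)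
    show "?h (1, t) = circlepath 0 1 t" for t by (simp add: circ e_cis)
    show "pathfinish (?h \<circ> Pair s) = pathstart (?h \<circ> Pair s)" for s
    proof -
      have "(1 - s) * g (2 * pi) + s * (2 * pi) = (1 - s) * g 0 + 2 * pi"
        using per[of 0] by (simp add: algebra_simps)
      then have "cis ((1 - s) * g (2 * pi) + s * (2 * pi)) = cis ((1 - s) * g 0)"
        by (simp only:) (simp add: complex_eq_iff)
      then show ?thesis by (simp add: pathfinish_def pathstart_def)
    qed
  qed
  have "winding_number (disk_ext \<circ> circlepath z r) (disk_ext z) = winding_number ?p 0"
    by (subst winding_number_offset) (simp add: o_def)
  also have "\<dots> = winding_number (circlepath 0 1) 0"
    by (rule winding_number_homotopic_loops[OF homotopic_loops_trans[OF h1 h2]])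
  also have "\<dots> = 1" by (rule winding_number_circlepath_centre) simp
  finally show ?thesis .
qed

lemma planar_homeo_pres_disk_ext: "planar_homeo_pres (ball 0 1) (ball 0 1) disk_ext"
proof -
  obtain G where "homeomorphism (cball 0 1) (cball 0 1) disk_ext G" by (rule disk_ext_homeomorphism)
  then have "homeomorphism (ball 0 1) (ball 0 1) disk_ext G"
    by (rule homeomorphism_of_subsets) (auto simp: disk_ext_ball)
  then show ?thesis
    unfolding planar_homeo_pres_def
    by (intro conjI allI impI exI[of _ G]) (simp_all add: winding_number_disk_ext)
qed

end


section \<open>Exponential integrability\<close>

lemma exp_ereal_mult_dilatation_le:
  assumes "0 < p" "0 < jac a b"
  shows "exp_ereal (ereal p * dilatation a b) \<le> ennreal (exp (p * frob_dilatation a b))"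
proof -
  have "ereal p * dilatation a b \<le> ereal p * ereal (frob_dilatation a b)"
    using assms by (intro ereal_mult_left_mono dilatation_le_frob_dilatation) auto
  then have le: "ereal p * dilatation a b \<le> ereal (p * frob_dilatation a b)" by simp
  then show ?thesis
    by (cases "ereal p * dilatation a b") (auto simp: exp_ereal_def intro!: ennreal_leI)
qed

lemma nn_integral_spherical_le:
  assumes [measurable]: "f \<in> borel_measurable borel"
  shows "(\<integral>\<^sup>+z. f z \<partial>spherical_measure) \<le> 4 * (\<integral>\<^sup>+z. f z \<partial>lborel)"
proof -
  let ?d = "\<lambda>z. ennreal (4 / (1 + (Re z)\<^sup>2 + (Im z)\<^sup>2)\<^sup>2)"
  have [measurable]: "?d \<in> borel_measurable lebesgue" "f \<in> borel_measurable lebesgue"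
    by (auto intro!: measurable_completion)
  have "(\<integral>\<^sup>+z. f z \<partial>spherical_measure) = (\<integral>\<^sup>+z. ?d z * f z \<partial>lebesgue)"
    unfolding spherical_measure_def by (rule nn_integral_density) measurable
  also have "\<dots> \<le> (\<integral>\<^sup>+z. 4 * f z \<partial>lebesgue)"
  proof (intro nn_integral_mono mult_right_mono)
    fix z
    define X where "X = (1 + (Re z)\<^sup>2 + (Im z)\<^sup>2)\<^sup>2"
    have "1 \<le> X" unfolding X_def by (rule one_le_power) simp
    then have "4 / X \<le> 4" by (subst pos_divide_le_eq) simp_all
    then show "?d z \<le> 4" using ennreal_leI[of "4 / X" 4] by (simp add: X_def)
  qed auto
  also have "\<dots> = 4 * (\<integral>\<^sup>+z. f z \<partial>lborel)"
    by (simp add: nn_integral_completion nn_integral_cmult)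
  finally show ?thesis .
qed

context circle_lift begin

text \<open>
  On the disk of radius \<open>exp (- \<pi>/2)\<close> the integrand is bounded by compactness. The remaining annulus
  corresponds to the heights \<open>0 < y < \<pi>/2\<close>, the range of \<open>t\<close> in the hypothesis.
\<close>

lemma exp_integrable_distortion_disk_ext:
  assumes q: "0 < q"
    and fin: "(\<integral>\<^sup>+x. \<integral>\<^sup>+t. ennreal (exp (q * distortion x t)) * indicator {0<..<pi/2} t * indicator {0..2*pi} x \<partial>lborel \<partial>lborel) < \<infinity>"
  shows "exp_integrable_distortion (ball 0 1) (ball 0 1) disk_ext"
proof -
  obtain Hx Hy where
    der: "\<And>z. z \<in> ball 0 1 \<Longrightarrow> (disk_ext has_derivative diff_map (Hx z) (Hy z)) (at z)"
    and cHx: "continuous_on (ball 0 1) Hx" and cHy: "continuous_on (ball 0 1) Hy"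
    and jac: "\<And>z. z \<in> ball 0 1 \<Longrightarrow> 0 < jac (Hx z) (Hy z)"
    and frob: "\<And>w. 0 < Im w \<Longrightarrow> frob_dilatation (Hx (exp (\<i> * w))) (Hy (exp (\<i> * w))) = frob_dilatation (BAx w) (BAy w)"
    by (rule disk_ext_C1, rule that)
  have cjac: "continuous_on (ball 0 1) (\<lambda>z. jac (Hx z) (Hy z))"
    unfolding jac_def by (intro continuous_intros cHx cHy)
  have fd: "finite_distortion_with (ball 0 1) (ball 0 1) disk_ext Hx Hy"
    unfolding finite_distortion_with_def
  proof (intro conjI)
    show "W11_loc (ball 0 1) disk_ext Hx Hy"
      by (rule W11_loc_of_continuous_derivative[OF _ der cHx cHy]) auto
    show "L1_loc (ball 0 1) (\<lambda>z. jac (Hx z) (Hy z))" by (rule L1_loc_continuous[OF cjac])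
    have "dilatation (Hx z) (Hy z) < \<infinity>" if "z \<in> ball 0 1" for z
      using dilatation_le_frob_dilatation[OF jac[OF that]] by (rule order_le_less_trans) simp
    then show "AE z in lebesgue. z \<in> ball 0 1 \<longrightarrow> dilatation (Hx z) (Hy z) < \<infinity>" by simp
  qed (rule planar_homeo_pres_disk_ext)
  define p where "p = q / 56"
  have p: "0 < p" using q by (simp add: p_def)
  define Q where "Q z = exp (p * frob_dilatation (Hx z) (Hy z))" for z
  define \<Phi> where "\<Phi> z = ennreal (indicator (ball 0 1) z * Q z)" for z :: complex
  have cQ: "continuous_on (ball 0 1) Q"
    unfolding Q_def frob_dilatation_def using jac
    by (intro continuous_intros cHx cHy cjac) force
  have "(\<lambda>z. indicator (ball 0 1) z *\<^sub>R Q z) \<in> borel_measurable borel"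
    using cQ by (intro borel_measurable_continuous_on_indicator) auto
  then have [measurable]: "\<Phi> \<in> borel_measurable borel" unfolding \<Phi>_def by simp
  have "(\<integral>\<^sup>+z\<in>ball 0 1. exp_ereal (ereal p * dilatation (Hx z) (Hy z)) \<partial>spherical_measure)
    \<le> (\<integral>\<^sup>+z. \<Phi> z \<partial>spherical_measure)"
    using exp_ereal_mult_dilatation_le[OF p jac]
    by (intro nn_integral_mono) (auto simp: \<Phi>_def Q_def split: split_indicator)
  also have "\<dots> \<le> 4 * (\<integral>\<^sup>+z. \<Phi> z \<partial>lborel)" by (rule nn_integral_spherical_le) measurable
  also have "\<dots> < \<infinity>"
  proof -
    let ?r = "exp (- (pi/2)) :: real"
    let ?A = "{z. exp (- (pi/2)) < norm z \<and> norm z < 1} :: complex set"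
    have r1: "?r < 1" by simp
    have [measurable]: "cball 0 ?r \<in> sets (borel :: complex measure)" by simp
    have "continuous_on (cball 0 ?r) Q" by (rule continuous_on_subset[OF cQ]) (simp add: cball_subset_ball_iff)
    then have "bounded (Q ` cball 0 ?r)"
      by (intro compact_imp_bounded compact_continuous_image) auto
    then obtain M where M: "\<And>z. z \<in> cball 0 ?r \<Longrightarrow> Q z \<le> M"
      unfolding bounded_iff by (metis abs_le_D1 imageI real_norm_def)
    have "(\<integral>\<^sup>+z. \<Phi> z \<partial>lborel) \<le> (\<integral>\<^sup>+z. ennreal M * indicator (cball 0 ?r) z + \<Phi> z * indicator ?A z \<partial>lborel)"
    proof (rule nn_integral_mono)
      fix z show "\<Phi> z \<le> ennreal M * indicator (cball 0 ?r) z + \<Phi> z * indicator ?A z"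
        using M[of z] r1 by (auto simp: \<Phi>_def intro!: ennreal_leI split: split_indicator)
    qed
    also have "\<dots> = ennreal M * emeasure lborel (cball 0 ?r :: complex set) + (\<integral>\<^sup>+z. \<Phi> z * indicator ?A z \<partial>lborel)"
      by (subst nn_integral_add) (auto simp: nn_integral_cmult_indicator)
    also have "\<dots> < \<infinity>"
    proof -
      have "emeasure lborel (cball 0 ?r :: complex set) < \<infinity>" by (rule emeasure_compact_finite) simp
      then have 1: "ennreal M * emeasure lborel (cball 0 ?r :: complex set) < \<infinity>"
        by (simp add: ennreal_mult_less_top)
      have "(\<integral>\<^sup>+z. \<Phi> z * indicator ?A z \<partial>lborel) \<le>
        (\<integral>\<^sup>+x. \<integral>\<^sup>+y. \<Phi> (exp (\<i> * Complex x y)) * indicator {0<..<pi/2} y * indicator {0..2*pi} x \<partial>lborel \<partial>lborel)"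
        by (rule nn_integral_polar_le) measurable
      also have "\<dots> \<le> (\<integral>\<^sup>+x. \<integral>\<^sup>+y. ennreal (exp (q / 56 * frob_dilatation (BAx (Complex x y)) (BAy (Complex x y))))
         * indicator {0<..<pi/2} y * indicator {0..2*pi} x \<partial>lborel \<partial>lborel)"
      proof (intro nn_integral_mono)
        fix x y :: real
        show "\<Phi> (exp (\<i> * Complex x y)) * indicator {0<..<pi/2} y * indicator {0..2*pi} x
          \<le> ennreal (exp (q / 56 * frob_dilatation (BAx (Complex x y)) (BAy (Complex x y)))) * indicator {0<..<pi/2} y * indicator {0..2*pi} x"
          using frob[of "Complex x y"]
          by (cases "0 < y") (auto simp: \<Phi>_def Q_def p_def split: split_indicator)
      qed
      also have "\<dots> < \<infinity>" by (rule exp_frob_dilatation_BA_integrable[OF q fin])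
      finally show ?thesis using 1 by simp
    qed
    finally show ?thesis by (simp add: ennreal_mult_less_top)
  qed
  finally show ?thesis
    unfolding exp_integrable_distortion_def using fd p by blast
qed

end


section \<open>The extension theorem\<close>

text \<open>
  The increment of the lift over a period is a positive multiple of \<open>2\<pi>\<close>. If it were larger than
  \<open>2\<pi>\<close>, then \<open>g\<close> would take the value \<open>g x + 2\<pi>\<close> strictly inside the period, and \<open>h\<close> would take a
  value twice.
\<close>

lemma circle_lift_of_circle_homeo:
  assumes h: "circle_homeo_pres h"
  obtains g where "circle_lift g" "\<And>\<theta>. h (cis \<theta>) = cis (g \<theta>)"
proof -
  obtain k where k: "homeomorphism (sphere 0 1) (sphere 0 1) h k" using h unfolding circle_homeo_pres_def by blast
  obtain g :: "real \<Rightarrow> real" where g: "continuous_on UNIV g" "strict_mono g" "\<And>\<theta>. h (cis \<theta>) = cis (g \<theta>)"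
    using h unfolding circle_homeo_pres_def by blast
  have cis_eq: "cis a = cis b \<longleftrightarrow> (\<exists>n::int. a = b + 2 * pi * of_int n)" for a b
    using exp_i_eq_iff[of "of_real a" "of_real b"] unfolding cis_conv_exp of_real_add[symmetric] of_real_eq_iff .
  have inj: "cis a = cis b" if "cis (g a) = cis (g b)" for a b
    using that k unfolding g(3)[symmetric] homeomorphism_def by (metis dist_0_norm mem_sphere norm_cis)
  have "g (x + 2*pi) = g x + 2*pi" for x
  proof -
    have "cis (g (x + 2*pi)) = cis (g x)"
    proof -
      have "cis (x + 2*pi) = cis x" unfolding cis_eq by (rule exI[of _ 1]) simp
      then show ?thesis using g(3) by metis
    qed
    then obtain n :: int where n: "g (x + 2*pi) = g x + 2 * pi * of_int n" unfolding cis_eq by blast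
    have "g x < g (x + 2*pi)" using g(2) by (simp add: strict_mono_less)
    then have "0 < 2 * pi * real_of_int n" using n by simp
    then have "0 < n" by (simp add: zero_less_mult_iff)
    moreover have "\<not> 1 < n"
    proof
      assume "1 < n"
      then have "2 * pi * 1 < 2 * pi * real_of_int n" by (intro mult_strict_left_mono) auto
      then have lt: "g x < g x + 2*pi" "g x + 2*pi < g (x + 2*pi)" using n by auto
      have "\<exists>s. x \<le> s \<and> s \<le> x + 2*pi \<and> g s = g x + 2*pi"
        using lt g(1) by (intro IVT') (auto intro: continuous_on_subset)
      then obtain s where s: "x \<le> s" "s \<le> x + 2*pi" "g s = g x + 2*pi" by blast
      have "cis (g s) = cis (g x)" unfolding cis_eq s(3) by (rule exI[of _ 1]) simp
      then obtain m :: int where m: "s = x + 2 * pi * of_int m" using inj cis_eq by blast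
      have "s \<noteq> x" "s \<noteq> x + 2*pi" using s(3) lt by auto
      then have "x < s" "s < x + 2*pi" using s by linarith+
      then have "0 < 2 * pi * real_of_int m" "2 * pi * real_of_int m < 2 * pi * 1" using m by linarith+
      then have "0 < m" "real_of_int m < 1" by (simp_all add: zero_less_mult_iff)
      then show False by simp
    qed
    ultimately have "n = 1" by linarith
    then show ?thesis using n by simp
  qed
  then have "circle_lift g" using g by unfold_locales auto
  then show ?thesis using that g(3) by blast
qed

lemma (in circle_lift) circ_distortion_eq:
  assumes h: "\<And>\<theta>. h (cis \<theta>) = cis (g \<theta>)" and t: "0 < t" "t < 2*pi"
  shows "circ_distortion h x t = distortion x t"
proof -
  have arc: "arc_len (h (cis a)) (h (cis b)) = g b - g a" if "a < b" "b < a + 2*pi" for a b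
  proof -
    have "g b < g (a + 2*pi)" "g a < g b" using that by simp_all
    then have r: "0 \<le> g b - g a" "g b - g a < 2*pi" using per[of a] by auto
    have "cis (g b) / cis (g a) = cis (g b - g a)" by (rule cis_divide)
    then have e: "of_real 1 * exp (\<i> * of_real (g b - g a)) = cis (g b) / cis (g a)"
      by (simp only: cis_conv_exp) simp
    show ?thesis unfolding arc_len_def h by (rule Arg2pi_unique[OF e]) (use r in auto)
  qed
  show ?thesis
    using arc[of x "x + t"] arc[of "x - t" x] t by (simp add: circ_distortion_def distortion_def)
qed

theorem theorem1p2:
  fixes h :: "complex \<Rightarrow> complex" and q :: real
  assumes "circle_homeo_pres h"
    and "0 < q"
    and "(\<integral>\<^sup>+\<theta>\<in>{0..2*pi}. (\<integral>\<^sup>+t\<in>{0<..<pi/2}. ennreal (exp (q * circ_distortion h \<theta> t)) \<partial>lborel)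
            \<partial>lborel) < \<infinity>"
  shows "\<exists>H. disk_extension h H \<and> exp_integrable_distortion (ball 0 1) (ball 0 1) H"
proof -
  obtain g where "circle_lift g" and lift: "\<And>\<theta>. h (cis \<theta>) = cis (g \<theta>)"
    using circle_lift_of_circle_homeo[OF assms(1)] by blast
  then interpret circle_lift g by simp
  have "(\<integral>\<^sup>+x. \<integral>\<^sup>+t. ennreal (exp (q * distortion x t)) * indicator {0<..<pi/2} t * indicator {0..2*pi} x \<partial>lborel \<partial>lborel)
    = (\<integral>\<^sup>+\<theta>\<in>{0..2*pi}. (\<integral>\<^sup>+t\<in>{0<..<pi/2}. ennreal (exp (q * circ_distortion h \<theta> t)) \<partial>lborel) \<partial>lborel)"
  proof (rule nn_integral_cong)
    fix x
    have "(\<integral>\<^sup>+t. ennreal (exp (q * distortion x t)) * indicator {0<..<pi/2} t \<partial>lborel)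
      = (\<integral>\<^sup>+t\<in>{0<..<pi/2}. ennreal (exp (q * circ_distortion h x t)) \<partial>lborel)"
      by (rule nn_integral_cong) (auto simp: circ_distortion_eq[OF lift] split: split_indicator)
    then show "(\<integral>\<^sup>+t. ennreal (exp (q * distortion x t)) * indicator {0<..<pi/2} t * indicator {0..2*pi} x \<partial>lborel)
      = (\<integral>\<^sup>+t\<in>{0<..<pi/2}. ennreal (exp (q * circ_distortion h x t)) \<partial>lborel) * indicator {0..2*pi} x"
      by (cases "x \<in> {0..2*pi}") auto
  qed
  then have "exp_integrable_distortion (ball 0 1) (ball 0 1) disk_ext"
    using assms by (intro exp_integrable_distortion_disk_ext[of q]) auto
  moreover have "disk_extension h disk_ext"
    unfolding disk_extension_def
  proof (intro conjI ballI)
    show "\<exists>G. homeomorphism (cball 0 1) (cball 0 1) disk_ext G"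
      using disk_ext_homeomorphism by blast
    show "disk_ext ` ball 0 1 = ball 0 1" by (rule disk_ext_ball)
    fix z :: complex assume "z \<in> sphere 0 1"
    then have "cmod z = 1" by simp
    then obtain \<theta> where "z = cis \<theta>"
      using complex_unimodular_polar by (metis cis.code complex_eq_iff complex.sel)
    then show "disk_ext z = h z" by (simp add: disk_ext_cis lift)
  qed
  ultimately show ?thesis by blast
qed

end
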